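(* Let $n\ge 2$. Suppose $\alpha_1,\alpha_2,\dots,\alpha_r\in S_n$ satisfy $$\Delta_n^+=\Phi(\alpha_1)\sqcup\Phi(\alpha_2)\sqcup\dots\sqcup\Phi(\alpha_r)$$ with all $\Phi(\alpha_a)\neq\emptyset$, indexed so that $(1,n)\in\Phi(\alpha_1)$. Let $\alpha_1=\sigma_1[\beta_{11},\beta_{12},\dots,\beta_{1m}]$ be the simple form expression of $\alpha_1$, with corresponding partition of $\{1,\dots,n\}$ into $m$ consecutive intervals of lengths $z_1,\dots,z_m$. Then, up to reordering of $\alpha_2,\dots,\alpha_r$, there exists a unique set of elements $\sigma_a\in S_m$ and $\beta_{ab}\in S_{z_b}$ ($a=2,\dots,r$, $b=1,\dots,m$) such that $\alpha_a=\sigma_a[\beta_{a1},\beta_{a2},\dots,\beta_{am}]$ for $a=2,\dots,r$, and (i) $\Delta_m^+=\Phi(\sigma_1)\sqcup\Phi(\sigma_2)\sqcup\dots\sqcup\Phi(\sigma_r)$, and $\Delta_{z_b}^+=\Phi(\beta_{1b})\sqcup\Phi(\beta_{2b})\sqcup\dots\sqcup\Phi(\beta_{rb})$ for each $b=1,\dots,m$; (ii) if $\alpha_1$ is minus-decomposable then $\sigma_1=J_m$ and $\sigma_2=\sigma_3=\dots=\sigma_r=I_m$; (iii) if $\alpha_1$ is minus-indecomposable then $\sigma_1$ is simple, $\sigma_2=J_m\sigma_1$, and $\sigma_3=\sigma_4=\dots=\sigma_r=I_m$. In particular, $\sigma_1$ and at most one other of the $\sigma_a$ are not the identity. Let $q$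 denote the number of $\sigma_a$ which are not $I_m$, i.e. $q=1$ if $\alpha_1$ is minus-decomposable and $q=2$ if $\alpha_1$ is minus-indecomposable. Then the decomposition $\Delta_n^+=\Phi(\alpha_1)\sqcup\Phi(\alpha_2)\sqcup\dots\sqcup\Phi(\alpha_r)$ is irreducible if and only if the following four conditions hold: (1) each of the decompositions $\Delta_{z_b}^+=\Phi(\beta_{1b})\sqcup\dots\sqcup\Phi(\beta_{rb})$, $b=1,\dots,m$, is irreducible; (2) for each $a=q+1,\dots,r$, exactly one of $\beta_{a1},\beta_{a2},\dots,\beta_{am}$ is not equal to the identity; (3) $\beta_{ab}=I_{z_b}$ for $a=1,\dots,q$ and $b=1,\dots,m$; (4) $m=2$ if $\alpha_1$ is minus-decomposable.
   Context: Permutations: $\alpha\in S_n$ is written $(\alpha(1),\dots,\alpha(n))$; $I_n$ is the identity and $J_n=(n,n-1,\dots,1)$; $J_m\sigma$ is the composition $i\mapsto J_m(\sigma(i))$. $\Delta_n^+=\{(i,j)\mid 1\le i<j\le n\}$, and the inversion set of $\alpha$ is $\Phi(\alpha)=\{(i,j)\in\Delta_n^+\mid \alpha(i)>\alpha(j)\}$. $\sqcup$ denotes disjoint union. Irreducibility: a decomposition of $\Phi(\alpha)$ is an expression $\Phi(\alpha)=\Phi(\alpha_1)\sqcup\dots\sqcup\Phi(\alpha_r)$ with $\alpha_i\in S_n$ (empty sets $\Phi(I_n)$ are allowed). It is trivial if $\Phi(\alpha)=\Phi(\alpha_a)$ for some $a$. $\alpha$ (and $\Phi(\alpha)$) is reducible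 if $\Phi(\alpha)$ has a non-trivial decomposition, and irreducible otherwise (so $I_n$ is irreducible). A decomposition is irreducible if every $\Phi(\alpha_i)$ in it is irreducible. Simple: a block of size $t$ of $\alpha\in S_n$ is a set of $t$ consecutive integers $\{i,\dots,i+t-1\}\subseteq\{1,\dots,n\}$ whose image under $\alpha$ is also a set of $t$ consecutive integers. $\alpha\in S_n$ is simple if it has no block of size $t$ for all $1<t<n$. Inflation: let $\{1,\dots,n\}=U_1\sqcup\dots\sqcup U_m$ be a partition into consecutive nonempty intervals (all elements of $U_i$ less than all elements of $U_j$ for $i<j$), $z_i=|U_i|$, $\sigma\in S_m$, $\beta_i\in S_{z_i}$. The inflation $\alpha=\sigma[\beta_1,\dots,\beta_m]\in S_n$ is the unique permutation such that (a) for each $i$, the sequence of values of $\alpha$ on $U_i$ (in increasing order of arguments) is order isomorphic to $\beta_i(1),\dots,\beta_i(z_i)$; (b) for $a\in U_i$, $b\in U_j$ with $i\ne j$, $\alpha(a)<\alpha(b)$ iff $\sigma(i)<\sigma(j)$. $\alpha$ is minus-decomposable if $\alpha=J_2[\beta_1,\beta_2]$ for some $\beta_1,\beta_2$, and minus-indecomposable otherwise; plus-decomposable if $\alpha=I_2[\beta_1,\beta_2]$ for some $\beta_1,\beta_2$, and plus-indecomposable otherwise. Simple form: for $n\ge2$, every $\alpha\in S_n$ can be written uniquely as $\alpha=\sigma[\beta_1,\dots,\beta_m]$ with $m\ge 2$ where either $\sigma\in S_m$ is simple and $m\ge4$, or $\sigma=I_m$ with $m$ maximal (each $\beta_b$ plus-indecomposable),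 or $\sigma=J_m$ with $m$ maximal (each $\beta_b$ minus-indecomposable). This is the simple form expression of $\alpha$. *)

theory Defs
  imports "HOL-Combinatorics.Combinatorics" "HOL-Library.Disjoint_Sets" "HOL-Library.FuncSet"
begin

(* An element of S_n is a function on nat that permutes {1..n} and is the identity elsewhere.
   So equality of permutations is equality of functions, I_n is id and composition is \<circ>. *)
definition perms :: "nat \<Rightarrow> (nat \<Rightarrow> nat) set" where
  "perms n = {\<pi>. \<pi> permutes {1..n}}"

definition J :: "nat \<Rightarrow> nat \<Rightarrow> nat" where
  "J n i = (if i \<in> {1..n} then n + 1 - i else i)"

definition Delta :: "nat \<Rightarrow> (nat \<times> nat) set" where
  "Delta n = {(i, j). 1 \<le> i \<and> i < j \<and> j \<le> n}"

definition Phi :: "nat \<Rightarrow> (nat \<Rightarrow> nat) \<Rightarrow> (nat \<times> nat) set" where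
  "Phi n \<alpha> = {(i, j) \<in> Delta n. \<alpha> i > \<alpha> j}"

(* A is the disjoint union of Phi(\<alpha> 1), ..., Phi(\<alpha> r).  Empty inversion sets may occur, also
   repeatedly: disjoint_family_on compares distinct indices, not distinct sets.  The condition
   r >= 1 rules out the empty expression for Phi(I_n), so that I_n is irreducible. *)
definition decomposition ::
  "nat \<Rightarrow> (nat \<times> nat) set \<Rightarrow> nat \<Rightarrow> (nat \<Rightarrow> nat \<Rightarrow> nat) \<Rightarrow> bool" where
  "decomposition n A r \<alpha> \<longleftrightarrow>
     1 \<le> r \<and> (\<forall>a\<in>{1..r}. \<alpha> a \<in> perms n) \<and>
     disjoint_family_on (\<lambda>a. Phi n (\<alpha> a)) {1..r} \<and>
     A = (\<Union>a\<in>{1..r}. Phi n (\<alpha> a))"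

definition trivial_decomposition ::
  "nat \<Rightarrow> (nat \<times> nat) set \<Rightarrow> nat \<Rightarrow> (nat \<Rightarrow> nat \<Rightarrow> nat) \<Rightarrow> bool" where
  "trivial_decomposition n A r \<alpha> \<longleftrightarrow>
     decomposition n A r \<alpha> \<and> (\<exists>a\<in>{1..r}. A = Phi n (\<alpha> a))"

definition reducible_perm :: "nat \<Rightarrow> (nat \<Rightarrow> nat) \<Rightarrow> bool" where
  "reducible_perm n \<pi> \<longleftrightarrow>
     (\<exists>r \<alpha>. decomposition n (Phi n \<pi>) r \<alpha> \<and> \<not> trivial_decomposition n (Phi n \<pi>) r \<alpha>)"

definition irreducible_perm :: "nat \<Rightarrow> (nat \<Rightarrow> nat) \<Rightarrow> bool" where
  "irreducible_perm n \<pi> \<longleftrightarrow> \<not> reducible_perm n \<pi>"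

definition irreducible_decomposition ::
  "nat \<Rightarrow> (nat \<times> nat) set \<Rightarrow> nat \<Rightarrow> (nat \<Rightarrow> nat \<Rightarrow> nat) \<Rightarrow> bool" where
  "irreducible_decomposition n A r \<alpha> \<longleftrightarrow>
     decomposition n A r \<alpha> \<and> (\<forall>a\<in>{1..r}. irreducible_perm n (\<alpha> a))"

definition is_block :: "nat \<Rightarrow> (nat \<Rightarrow> nat) \<Rightarrow> nat \<Rightarrow> nat set \<Rightarrow> bool" where
  "is_block n \<alpha> t B \<longleftrightarrow>
     B \<subseteq> {1..n} \<and> (\<exists>i. B = {i..<i + t}) \<and> (\<exists>j. \<alpha> ` B = {j..<j + t})"

definition simple_perm :: "nat \<Rightarrow> (nat \<Rightarrow> nat) \<Rightarrow> bool" where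
  "simple_perm n \<alpha> \<longleftrightarrow> \<alpha> \<in> perms n \<and> (\<forall>t. 1 < t \<and> t < n \<longrightarrow> \<not> (\<exists>B. is_block n \<alpha> t B))"

(* A partition of {1..n} into m consecutive nonempty intervals U_1, ..., U_m is given by the
   lengths z 1, ..., z m of the intervals; segment z b is U_b. *)
definition interval_partition :: "nat \<Rightarrow> nat \<Rightarrow> (nat \<Rightarrow> nat) \<Rightarrow> bool" where
  "interval_partition n m z \<longleftrightarrow> (\<forall>b\<in>{1..m}. 1 \<le> z b) \<and> sum z {1..m} = n"

definition segment :: "(nat \<Rightarrow> nat) \<Rightarrow> nat \<Rightarrow> nat set" where
  "segment z b = {sum z {1..<b} <.. sum z {1..b}}"

(* is_inflation n m z \<sigma> \<beta> \<alpha> says \<alpha> = \<sigma>[\<beta> 1, ..., \<beta> m] with respect to the partition z.  The k-th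
   element of segment z b is sum z {1..<b} + k. *)
definition is_inflation ::
  "nat \<Rightarrow> nat \<Rightarrow> (nat \<Rightarrow> nat) \<Rightarrow> (nat \<Rightarrow> nat) \<Rightarrow> (nat \<Rightarrow> nat \<Rightarrow> nat) \<Rightarrow> (nat \<Rightarrow> nat) \<Rightarrow> bool" where
  "is_inflation n m z \<sigma> \<beta> \<alpha> \<longleftrightarrow>
     interval_partition n m z \<and> \<sigma> \<in> perms m \<and> (\<forall>b\<in>{1..m}. \<beta> b \<in> perms (z b)) \<and>
     \<alpha> \<in> perms n \<and>
     (\<forall>b\<in>{1..m}. \<forall>k\<in>{1..z b}. \<forall>l\<in>{1..z b}.
        \<alpha> (sum z {1..<b} + k) < \<alpha> (sum z {1..<b} + l) \<longleftrightarrow> \<beta> b k < \<beta> b l) \<and>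
     (\<forall>i\<in>{1..m}. \<forall>j\<in>{1..m}. i \<noteq> j \<longrightarrow>
        (\<forall>x\<in>segment z i. \<forall>y\<in>segment z j. \<alpha> x < \<alpha> y \<longleftrightarrow> \<sigma> i < \<sigma> j))"

definition minus_decomposable :: "nat \<Rightarrow> (nat \<Rightarrow> nat) \<Rightarrow> bool" where
  "minus_decomposable n \<alpha> \<longleftrightarrow> (\<exists>z \<beta>. is_inflation n 2 z (J 2) \<beta> \<alpha>)"

definition plus_decomposable :: "nat \<Rightarrow> (nat \<Rightarrow> nat) \<Rightarrow> bool" where
  "plus_decomposable n \<alpha> \<longleftrightarrow> (\<exists>z \<beta>. is_inflation n 2 z id \<beta> \<alpha>)"

definition simple_form ::
  "nat \<Rightarrow> (nat \<Rightarrow> nat) \<Rightarrow> nat \<Rightarrow> (nat \<Rightarrow> nat) \<Rightarrow> (nat \<Rightarrow> nat) \<Rightarrow> (nat \<Rightarrow> nat \<Rightarrow> nat) \<Rightarrow> bool" where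
  "simple_form n \<alpha> m z \<sigma> \<beta> \<longleftrightarrow>
     2 \<le> m \<and> is_inflation n m z \<sigma> \<beta> \<alpha> \<and>
     (simple_perm m \<sigma> \<and> 4 \<le> m \<or>
      \<sigma> = id \<and> (\<forall>b\<in>{1..m}. \<not> plus_decomposable (z b) (\<beta> b)) \<or>
      \<sigma> = J m \<and> (\<forall>b\<in>{1..m}. \<not> minus_decomposable (z b) (\<beta> b)))"

(* Given \<alpha> 1 = \<sigma>1[\<beta>1 1, ..., \<beta>1 m], the families \<sigma> a, \<beta> a b (a in {1..r}, b in {1..m}) extend
   \<sigma>1, \<beta>1 to all of \<alpha> 1, ..., \<alpha> r.  The families are extensional (PiE), so that equality of
   families means equality at all indices in range.  In the last clause 2 <= r is required because
   \<sigma> 2 has to be a member of the family. *)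
definition compatible_inflations ::
  "nat \<Rightarrow> nat \<Rightarrow> (nat \<Rightarrow> nat \<Rightarrow> nat) \<Rightarrow> nat \<Rightarrow> (nat \<Rightarrow> nat) \<Rightarrow> (nat \<Rightarrow> nat) \<Rightarrow> (nat \<Rightarrow> nat \<Rightarrow> nat) \<Rightarrow>
   (nat \<Rightarrow> nat \<Rightarrow> nat) \<Rightarrow> (nat \<Rightarrow> nat \<Rightarrow> nat \<Rightarrow> nat) \<Rightarrow> bool" where
  "compatible_inflations n r \<alpha> m z \<sigma>1 \<beta>1 \<sigma> \<beta> \<longleftrightarrow>
     \<sigma> \<in> {1..r} \<rightarrow>\<^sub>E perms m \<and>
     \<beta> \<in> (\<Pi>\<^sub>E a\<in>{1..r}. \<Pi>\<^sub>E b\<in>{1..m}. perms (z b)) \<and>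
     \<sigma> 1 = \<sigma>1 \<and> (\<forall>b\<in>{1..m}. \<beta> 1 b = \<beta>1 b) \<and>
     (\<forall>a\<in>{2..r}. is_inflation n m z (\<sigma> a) (\<beta> a) (\<alpha> a)) \<and>
     decomposition m (Delta m) r \<sigma> \<and>
     (\<forall>b\<in>{1..m}. decomposition (z b) (Delta (z b)) r (\<lambda>a. \<beta> a b)) \<and>
     (minus_decomposable n (\<alpha> 1) \<longrightarrow> \<sigma> 1 = J m \<and> (\<forall>a\<in>{2..r}. \<sigma> a = id)) \<and>
     (\<not> minus_decomposable n (\<alpha> 1) \<longrightarrow>
        simple_perm m (\<sigma> 1) \<and> 2 \<le> r \<and> \<sigma> 2 = J m \<circ> \<sigma> 1 \<and> (\<forall>a\<in>{3..r}. \<sigma> a = id))"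

end

(* Colour a pair i < j by the index a with (i, j) in Phi(alpha_a).  The sets Phi(alpha_a) and their
   complements are transitively closed, so c(i, k) is c(i, j) or c(j, k) for i < j < k.  For such a
   (Gallai type) colouring and any three colours, one of the colours does not occur between {1..t}
   and {t+1..n} for some t; an interval that is minimal with no edge of this colour leaving it is
   then a block for all unions of colours.  An interval block of an inflation of a simple
   permutation meeting two segments is everything, so apart from colour 1 only one colour occurs
   between different segments, which gives the sigma_a.  The same argument with three colours
   (complement, S, T) for a splitting Phi(alpha_a) = S + T gives irreducibility. *)
theory Submission
  imports Defs
begin

section \<open>Inversion sets as biclosed sets\<close>

text \<open>Three is the right number of colours. For the permutation 2413 both inversions and
  non-inversions occur across every threshold, so two colours can avoid all cuts; this is the room
  that a simple quotient leaves for \<open>\<alpha> 1\<close> and one partner. To test a candidate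
  partner, all other members with index at least 2 are merged into a single colour. The merged set
  is again the inversion set of a permutation, which is why the argument runs on biclosed sets of
  pairs and returns to permutations only at the end. The inversion \<open>(1, n)\<close> excludes
  the quotient \<open>id\<close>, because 1 and n lie in the first and in the last segment. Only the
  simple quotient is hard. There \<open>3 \<le> m\<close> has to accompany simplicity: permutations
  of two points are vacuously simple, but their inflations do have cuts.\<close>

definition biclosed :: "nat \<Rightarrow> (nat \<times> nat) set \<Rightarrow> bool" where
  "biclosed n S \<longleftrightarrow> S \<subseteq> Delta n \<and>
     (\<forall>i j k. (i, j) \<in> S \<longrightarrow> (j, k) \<in> S \<longrightarrow> (i, k) \<in> S) \<and>
     (\<forall>i j k. i < j \<longrightarrow> j < k \<longrightarrow> (i, k) \<in> S \<longrightarrow> (i, j) \<in> S \<or> (j, k) \<in> S)"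

lemma mem_Delta [simp]: "(i, j) \<in> Delta n \<longleftrightarrow> 1 \<le> i \<and> i < j \<and> j \<le> n"
  by (simp add: Delta_def)

lemma mem_Phi [simp]: "(i, j) \<in> Phi n \<alpha> \<longleftrightarrow> 1 \<le> i \<and> i < j \<and> j \<le> n \<and> \<alpha> j < \<alpha> i"
  by (auto simp: Phi_def)

lemma biclosedD:
  assumes "biclosed n S"
  shows "\<And>i j. (i, j) \<in> S \<Longrightarrow> 1 \<le> i \<and> i < j \<and> j \<le> n"
    and "\<And>i j k. (i, j) \<in> S \<Longrightarrow> (j, k) \<in> S \<Longrightarrow> (i, k) \<in> S"
    and "\<And>i j k. i < j \<Longrightarrow> j < k \<Longrightarrow> (i, k) \<in> S \<Longrightarrow> (i, j) \<in> S \<or> (j, k) \<in> S"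
proof -
  show "1 \<le> i \<and> i < j \<and> j \<le> n" if "(i, j) \<in> S" for i j
    using assms that mem_Delta[of i j n] unfolding biclosed_def by blast
qed (use assms in \<open>unfold biclosed_def, blast+\<close>)

lemma biclosedI:
  assumes "\<And>i j. (i, j) \<in> S \<Longrightarrow> 1 \<le> i \<and> i < j \<and> j \<le> n"
    and "\<And>i j k. (i, j) \<in> S \<Longrightarrow> (j, k) \<in> S \<Longrightarrow> (i, k) \<in> S"
    and "\<And>i j k. i < j \<Longrightarrow> j < k \<Longrightarrow> (i, k) \<in> S \<Longrightarrow> (i, j) \<in> S \<or> (j, k) \<in> S"
  shows "biclosed n S"
  unfolding biclosed_def
proof (intro conjI allI impI)
  show "S \<subseteq> Delta n" by (rule subrelI) (use assms(1) in simp)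
qed (use assms(2,3) in blast)+

lemma Phi_subset_Delta: "Phi n \<alpha> \<subseteq> Delta n"
  by (auto simp: Phi_def)

lemma Phi_id [simp]: "Phi n id = {}"
  by (auto simp: Phi_def)

lemma perms_inj: "\<alpha> \<in> perms n \<Longrightarrow> \<alpha> x = \<alpha> y \<longleftrightarrow> x = y"
  by (metis mem_Collect_eq perms_def permutes_def)

lemma perms_mem: "\<alpha> \<in> perms n \<Longrightarrow> \<alpha> x \<in> {1..n} \<longleftrightarrow> x \<in> {1..n}"
  by (metis mem_Collect_eq perms_def permutes_in_image)

lemma id_perms [simp]: "id \<in> perms n"
  by (simp add: perms_def permutes_id)

lemma biclosed_Phi: "biclosed n (Phi n \<alpha>)"
  by (auto simp: biclosed_def Phi_def)

text \<open>Each of the two closure conditions for \<open>S\<close> is the contrapositive of the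
  other one for the complement.\<close>

lemma biclosed_Delta_minus:
  assumes "biclosed n S"
  shows "biclosed n (Delta n - S)"
proof -
  have "(i, k) \<in> Delta n - S" if "(i, j) \<in> Delta n - S" "(j, k) \<in> Delta n - S" for i j k
  proof -
    have "(i, k) \<notin> S" using that assms unfolding biclosed_def by (meson DiffE mem_Delta)
    then show ?thesis using that by auto
  qed
  moreover have "(i, j) \<in> Delta n - S \<or> (j, k) \<in> Delta n - S"
    if "i < j" "j < k" "(i, k) \<in> Delta n - S" for i j k
  proof -
    have "(i, j) \<notin> S \<or> (j, k) \<notin> S" using that assms unfolding biclosed_def by blast
    then show ?thesis using that by auto
  qed
  ultimately show ?thesis unfolding biclosed_def by blast
qed

section \<open>Permutations correspond to biclosed sets\<close>

lemma perms_eqI: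
  assumes "\<alpha> \<in> perms n" "\<beta> \<in> perms n"
    and ord: "\<And>x y. x \<in> {1..n} \<Longrightarrow> y \<in> {1..n} \<Longrightarrow> x < y \<Longrightarrow> \<alpha> x < \<alpha> y \<longleftrightarrow> \<beta> x < \<beta> y"
  shows "\<alpha> = \<beta>"
proof -
  \<comment> \<open>A value is its own rank: \<open>\<gamma>\<close> maps the points with value at
    most \<open>\<gamma> x\<close> onto \<open>{1..\<gamma> x}\<close>. Hence the values can be
    recovered from comparisons alone.\<close>
  have rank: "\<gamma> x = card {y \<in> {1..n}. \<gamma> y \<le> \<gamma> x}"
    if \<gamma>: "\<gamma> \<in> perms n" and x: "x \<in> {1..n}" for \<gamma> :: "nat \<Rightarrow> nat" and x
  proof -
    have p: "\<gamma> permutes {1..n}" using \<gamma> by (simp add: perms_def)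
    have "\<gamma> ` {y \<in> {1..n}. \<gamma> y \<le> \<gamma> x} = {1..\<gamma> x}"
    proof
      show "\<gamma> ` {y \<in> {1..n}. \<gamma> y \<le> \<gamma> x} \<subseteq> {1..\<gamma> x}"
        using perms_mem[OF \<gamma>] by fastforce
      show "{1..\<gamma> x} \<subseteq> \<gamma> ` {y \<in> {1..n}. \<gamma> y \<le> \<gamma> x}"
      proof
        fix v assume v: "v \<in> {1..\<gamma> x}"
        have "\<gamma> x \<in> {1..n}" using perms_mem[OF \<gamma>] x by blast
        then have "v \<in> \<gamma> ` {1..n}" using v permutes_image[OF p] by auto
        then show "v \<in> \<gamma> ` {y \<in> {1..n}. \<gamma> y \<le> \<gamma> x}" using v by auto
      qed
    qed
    then have "card {1..\<gamma> x} = card {y \<in> {1..n}. \<gamma> y \<le> \<gamma> x}"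
      by (metis card_image inj_on_subset permutes_inj p subset_UNIV)
    then show ?thesis by simp
  qed
  have iff: "\<alpha> y \<le> \<alpha> x \<longleftrightarrow> \<beta> y \<le> \<beta> x" if "x \<in> {1..n}" "y \<in> {1..n}" for x y
  proof (cases x y rule: linorder_cases)
    case less
    then show ?thesis using ord[OF that] perms_inj[OF assms(1), of x y] perms_inj[OF assms(2), of x y]
      by linarith
  next
    case greater
    then show ?thesis using ord[OF that(2,1)] perms_inj[OF assms(1), of x y] perms_inj[OF assms(2), of x y]
      by linarith
  qed simp
  show ?thesis
  proof
    fix x
    show "\<alpha> x = \<beta> x"
    proof (cases "x \<in> {1..n}")
      case True
      then have eq: "{y \<in> {1..n}. \<alpha> y \<le> \<alpha> x} = {y \<in> {1..n}. \<beta> y \<le> \<beta> x}"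
        using iff by blast
      have "\<alpha> x = card {y \<in> {1..n}. \<alpha> y \<le> \<alpha> x}" by (rule rank[OF assms(1) True])
      also have "\<dots> = card {y \<in> {1..n}. \<beta> y \<le> \<beta> x}" by (simp only: eq)
      also have "\<dots> = \<beta> x" by (rule rank[OF assms(2) True, symmetric])
      finally show ?thesis .
    next
      case False
      then show ?thesis using assms(1,2) by (metis mem_Collect_eq perms_def permutes_not_in)
    qed
  qed
qed

lemma Phi_inj:
  assumes "\<alpha> \<in> perms n" "\<beta> \<in> perms n" "Phi n \<alpha> = Phi n \<beta>"
  shows "\<alpha> = \<beta>"
proof (rule perms_eqI[OF assms(1,2)])
  fix x y assume xy: "x \<in> {1..n}" "y \<in> {1..n}" "x < y"
  have "(x, y) \<in> Phi n \<alpha> \<longleftrightarrow> (x, y) \<in> Phi n \<beta>" using assms(3) by simp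
  then have "\<alpha> y < \<alpha> x \<longleftrightarrow> \<beta> y < \<beta> x" using xy by simp
  then show "\<alpha> x < \<alpha> y \<longleftrightarrow> \<beta> x < \<beta> y"
    using perms_inj[OF assms(1), of x y] perms_inj[OF assms(2), of x y] xy(3) by linarith
qed

lemma Phi_empty_iff:
  assumes "\<alpha> \<in> perms n"
  shows "Phi n \<alpha> = {} \<longleftrightarrow> \<alpha> = id"
  using Phi_inj[OF assms id_perms] by auto

text \<open>\<open>L\<close> is the natural order with the pairs of \<open>S\<close> reversed. The
  two closure conditions make it a linear order, and \<open>\<alpha>\<close> sends each point to its
  rank in that order, so exactly the reversed pairs become inversions.\<close>

lemma biclosed_imp_Phi:
  assumes S: "biclosed n S"
  obtains \<alpha> where "\<alpha> \<in> perms n" "Phi n \<alpha> = S"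
proof -
  define L where "L x y \<longleftrightarrow> x = y \<or> (x < y \<and> (x, y) \<notin> S) \<or> (y < x \<and> (y, x) \<in> S)" for x y
  define \<alpha> where "\<alpha> x = (if x \<in> {1..n} then card {y \<in> {1..n}. L y x} else x)" for x
  have sub: "S \<subseteq> Delta n"
    and cl: "\<And>i j k. (i, j) \<in> S \<Longrightarrow> (j, k) \<in> S \<Longrightarrow> (i, k) \<in> S"
    and co: "\<And>i j k. i < j \<Longrightarrow> j < k \<Longrightarrow> (i, k) \<in> S \<Longrightarrow> (i, j) \<in> S \<or> (j, k) \<in> S"
    using S by (auto simp: biclosed_def)
  have lt: "i < j" if "(i, j) \<in> S" for i j using subsetD[OF sub that] by simp
  have trans: "L x w" if "L x y" "L y w" for x y w
  proof (cases "x = y \<or> y = w \<or> x = w")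
    case True
    then show ?thesis using that by (auto simp: L_def)
  next
    case False
    \<comment> \<open>In each of the six arrangements of three distinct points a single closure
      condition suffices: co-closedness in cases 1, 4 and 5, transitivity in cases 2, 3 and
      6.\<close>
    then consider "x < y" "y < w" | "x < w" "w < y" | "y < x" "x < w" | "y < w" "w < x"
      | "w < x" "x < y" | "w < y" "y < x" by linarith
    moreover have Ll: "L u v \<longleftrightarrow> (u, v) \<notin> S" and Lg: "L v u \<longleftrightarrow> (u, v) \<in> S" if "u < v" for u v
      using that by (auto simp: L_def)
    ultimately show ?thesis
    proof cases
      case 1 then show ?thesis using that co[of x y w] Ll[of x y] Ll[of y w] Ll[of x w] by auto
    next
      case 2 then show ?thesis using that cl[of x w y] Ll[of x y] Lg[of w y] Ll[of x w] by auto
    next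
      case 3 then show ?thesis using that cl[of y x w] Lg[of y x] Ll[of y w] Ll[of x w] by auto
    next
      case 4 then show ?thesis using that co[of y w x] Lg[of y x] Ll[of y w] Lg[of w x] by auto
    next
      case 5 then show ?thesis using that co[of w x y] Ll[of x y] Lg[of w y] Lg[of w x] by auto
    next
      case 6 then show ?thesis using that cl[of w y x] Lg[of y x] Lg[of w y] Lg[of w x] by auto
    qed
  qed
  have anti: "x = y" if "L x y" "L y x" for x y
    using that unfolding L_def by auto
  have tot: "L x y \<or> L y x" for x y unfolding L_def by (meson linorder_neqE_nat)
  have less: "\<alpha> x < \<alpha> y" if "L x y" "x \<noteq> y" "x \<in> {1..n}" "y \<in> {1..n}" for x y
  proof -
    have "{w \<in> {1..n}. L w x} \<subset> {w \<in> {1..n}. L w y}"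
    proof (rule psubsetI)
      show "{w \<in> {1..n}. L w x} \<subseteq> {w \<in> {1..n}. L w y}" using trans that by blast
      have "L y y" "\<not> L y x" using anti that by (auto simp: L_def)
      then show "{w \<in> {1..n}. L w x} \<noteq> {w \<in> {1..n}. L w y}" using that by blast
    qed
    then show ?thesis using that by (simp add: \<alpha>_def psubset_card_mono)
  qed
  have inj: "inj_on \<alpha> {1..n}"
  proof (rule inj_onI)
    fix x y assume xy: "x \<in> {1..n}" "y \<in> {1..n}" "\<alpha> x = \<alpha> y"
    show "x = y" using less[of x y] less[of y x] tot[of x y] xy by force
  qed
  have img: "\<alpha> ` {1..n} \<subseteq> {1..n}"
  proof
    fix v assume "v \<in> \<alpha> ` {1..n}"
    then obtain x where x: "x \<in> {1..n}" "v = card {y \<in> {1..n}. L y x}"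
      by (auto simp: \<alpha>_def)
    have "x \<in> {y \<in> {1..n}. L y x}" using x by (auto simp: L_def)
    then have "v > 0" using x by (auto simp: card_gt_0_iff)
    moreover have "v \<le> card {1..n}" unfolding x(2) by (rule card_mono) auto
    ultimately show "v \<in> {1..n}" by auto
  qed
  have "bij_betw \<alpha> {1..n} {1..n}"
    using inj img endo_inj_surj[of "{1..n}" \<alpha>] by (simp add: bij_betw_def)
  then have "\<alpha> permutes {1..n}" by (rule bij_imp_permutes) (auto simp: \<alpha>_def)
  moreover have "Phi n \<alpha> = S"
  proof -
    have "\<alpha> y < \<alpha> x \<longleftrightarrow> (x, y) \<in> S" if "x \<in> {1..n}" "y \<in> {1..n}" "x < y" for x y
    proof (cases "(x, y) \<in> S")
      case True
      then show ?thesis using less[of y x] that by (simp add: L_def)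
    next
      case False
      then show ?thesis using less[of x y] that by (simp add: L_def)
    qed
    then have "(x, y) \<in> Phi n \<alpha> \<longleftrightarrow> (x, y) \<in> S" for x y
      using subsetD[OF sub, of "(x, y)"] by auto
    then show ?thesis by auto
  qed
  ultimately show ?thesis using that by (auto simp: perms_def)
qed

text \<open>Transitivity is the delicate half. If \<open>(i, j)\<close> and \<open>(j, k)\<close>
  have colours a and b in \<open>B\<close>, then \<open>(i, k)\<close> has some colour c of the
  whole family; co-closedness of \<open>F c\<close> puts colour c on one of the two short pairs, and
  disjointness gives c = a or c = b.\<close>

lemma biclosed_UN:
  assumes "biclosed n (\<Union>a\<in>A. F a)" "disjoint_family_on F A" and F: "\<And>a. a \<in> A \<Longrightarrow> biclosed n (F a)"
    and "B \<subseteq> A"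
  shows "biclosed n (\<Union>a\<in>B. F a)"
proof (rule biclosedI)
  fix i j assume "(i, j) \<in> (\<Union>a\<in>B. F a)"
  then obtain a where "a \<in> B" "(i, j) \<in> F a" by blast
  then show "1 \<le> i \<and> i < j \<and> j \<le> n" using biclosedD(1)[OF F] assms(4) by blast
next
  fix i j k assume "(i, j) \<in> (\<Union>a\<in>B. F a)" "(j, k) \<in> (\<Union>a\<in>B. F a)"
  then obtain a b where a: "a \<in> B" "(i, j) \<in> F a" and b: "b \<in> B" "(j, k) \<in> F b" by blast
  have A: "a \<in> A" "b \<in> A" using a b assms(4) by auto
  have "(i, k) \<in> (\<Union>a\<in>A. F a)"
    by (rule biclosedD(2)[OF assms(1), of i j k]) (use a b A in blast)+
  then obtain c where c: "c \<in> A" "(i, k) \<in> F c" by blast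
  have "i < j" "j < k" using biclosedD(1)[OF F[OF A(1)] a(2)] biclosedD(1)[OF F[OF A(2)] b(2)] by auto
  then have "(i, j) \<in> F c \<or> (j, k) \<in> F c" using biclosedD(3)[OF F[OF c(1)]] c(2) by blast
  then have "c = a \<or> c = b"
    using disjoint_family_onD[OF assms(2) c(1) A(1)] disjoint_family_onD[OF assms(2) c(1) A(2)] a b
    by blast
  then show "(i, k) \<in> (\<Union>a\<in>B. F a)" using a b c by blast
next
  fix i j k :: nat assume ijk: "i < j" "j < k" "(i, k) \<in> (\<Union>a\<in>B. F a)"
  then obtain a where a: "a \<in> B" "(i, k) \<in> F a" by blast
  then have "(i, j) \<in> F a \<or> (j, k) \<in> F a" using biclosedD(3)[OF F] assms(4) ijk by blast
  then show "(i, j) \<in> (\<Union>a\<in>B. F a) \<or> (j, k) \<in> (\<Union>a\<in>B. F a)" using a by blast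
qed

section \<open>Cuts and components of Gallai colourings\<close>

text \<open>Only the longest edge of a triangle is constrained. This is stronger than forbidding
  triangles with three colours: it also forbids two short edges of one colour under a long edge of
  another.\<close>

definition gallai :: "nat \<Rightarrow> (nat \<Rightarrow> nat \<Rightarrow> 'c) \<Rightarrow> bool" where
  "gallai n c \<longleftrightarrow> (\<forall>i j k. 1 \<le> i \<longrightarrow> i < j \<longrightarrow> j < k \<longrightarrow> k \<le> n \<longrightarrow> c i k = c i j \<or> c i k = c j k)"

definition cut :: "(nat \<Rightarrow> nat \<Rightarrow> 'c) \<Rightarrow> 'c \<Rightarrow> nat \<Rightarrow> nat \<Rightarrow> nat \<Rightarrow> bool" where
  "cut c X l u t \<longleftrightarrow> l \<le> t \<and> t < u \<and> (\<forall>i\<in>{l..t}. \<forall>j\<in>{t<..u}. c i j \<noteq> X)"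

lemma gallaiD:
  assumes "gallai n c" "1 \<le> i" "i < j" "j < k" "k \<le> n"
  shows "c i k = c i j \<or> c i k = c j k"
  using assms unfolding gallai_def by blast

lemma cutD: "cut c X l u t \<Longrightarrow> l \<le> i \<Longrightarrow> i \<le> t \<Longrightarrow> t < j \<Longrightarrow> j \<le> u \<Longrightarrow> c i j \<noteq> X"
  by (simp add: cut_def)

text \<open>An arbitrary bipartition of the interval without \<open>X\<close>-edges between its
  sides already yields a cut at a threshold. The threshold lies just before the first point w on the
  other side than l. An edge from the left of w to a point beyond w on the side of l passes over w,
  and both of its shorter edges at w connect different sides.\<close>

lemma split_cut:
  assumes "gallai n c" "1 \<le> l" "u \<le> n"
    and nc: "a \<in> {l..u}" "b \<in> {l..u}" "P a \<noteq> P b"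
    and X: "\<And>i j. l \<le> i \<Longrightarrow> i < j \<Longrightarrow> j \<le> u \<Longrightarrow> P i \<noteq> P j \<Longrightarrow> c i j \<noteq> X"
  obtains t where "cut c X l u t"
proof -
  have "\<exists>x. l < x \<and> x \<le> u \<and> P x \<noteq> P l"
  proof (cases "P a = P l")
    case True
    then have "l < b \<and> b \<le> u \<and> P b \<noteq> P l" using nc by (cases "b = l") auto
    then show ?thesis by blast
  next
    case False
    then have "l < a \<and> a \<le> u \<and> P a \<noteq> P l" using nc by (cases "a = l") auto
    then show ?thesis by blast
  qed
  then obtain w where w: "l < w \<and> w \<le> u \<and> P w \<noteq> P l"
      and least: "\<And>y. y < w \<Longrightarrow> \<not> (l < y \<and> y \<le> u \<and> P y \<noteq> P l)"
    using exists_least_iff[of "\<lambda>x. l < x \<and> x \<le> u \<and> P x \<noteq> P l"] by auto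
  have low: "P i = P l" if "l \<le> i" "i < w" for i
    using least[OF that(2)] that w by (cases "i = l") auto
  have "c i j \<noteq> X" if "l \<le> i" "i < w" "w \<le> j" "j \<le> u" for i j
  proof (cases "P j = P l")
    case False
    then show ?thesis using X[of i j] low[OF that(1,2)] that by simp
  next
    case True
    then have j: "w < j" using w that by (cases "j = w") auto
    have "c i w \<noteq> X" using X[of i w] low[OF that(1,2)] that w by simp
    moreover have "c w j \<noteq> X" using X[of w j] j True that w by simp
    moreover have "c i j = c i w \<or> c i j = c w j"
      by (rule gallaiD[OF assms(1)]) (use that j assms in auto)
    ultimately show ?thesis by metis
  qed
  note sep = this
  have "c i j \<noteq> X" if "i \<in> {l..w - 1}" "j \<in> {w - 1<..u}" for i j
    by (rule sep) (use that w in auto)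
  then have "cut c X l u (w - 1)" using w unfolding cut_def by auto
  then show ?thesis by (rule that)
qed

text \<open>If the new point \<open>Suc n\<close> destroyed all cuts, it would have to be joined to
  the left part of the leftmost \<open>Z\<close>-cut in colour \<open>Z\<close> and also in the
  colours \<open>X\<close> and \<open>Y\<close>. The last two force a \<open>Z\<close>-cut even
  further to the left.\<close>

lemma gallai_cut_step:
  assumes g: "gallai (Suc n) c" and ne: "X \<noteq> Y" "X \<noteq> Z" "Y \<noteq> Z" and Z: "cut c Z 1 n t0"
  shows "\<exists>W\<in>{X, Y, Z}. \<exists>t. cut c W 1 (Suc n) t"
proof (rule ccontr)
  assume no: "\<not> ?thesis"
  \<comment> \<open>The leftmost \<open>Z\<close>-cut is taken, so that a smaller one is a
    contradiction.\<close>
  obtain k where k: "cut c Z 1 n k" and least: "\<And>t. t < k \<Longrightarrow> \<not> cut c Z 1 n t"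
    using exists_least_iff[of "\<lambda>t. cut c Z 1 n t"] Z by blast
  have kn: "1 \<le> k" "k < n" using k by (auto simp: cut_def)
  have "\<not> cut c Z 1 (Suc n) k" using no by blast
  then obtain i j where ij: "1 \<le> i" "i \<le> k" "k < j" "j \<le> Suc n" "c i j = Z"
    using kn by (auto simp: cut_def)
  then have iZ: "c i (Suc n) = Z" using cutD[OF k, of i j] by (cases "j = Suc n") auto
  \<comment> \<open>In the triangle i, j, \<open>Suc n\<close> the long edge has colour
    \<open>Z\<close> and the edge from i to j crosses the cut, so the colour \<open>Z\<close> must
    come from the edge between j and \<open>Suc n\<close>.\<close>
  have nZ: "c j (Suc n) = Z" if j: "k < j" "j \<le> n" for j
    using gallaiD[OF g, of i j "Suc n"] cutD[OF k, of i j] ij(1,2) iZ j by auto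
  \<comment> \<open>Since n is no cut for W, some edge into \<open>Suc n\<close> has colour W. It
    starts left of the cut, because all edges from the right of it have colour \<open>Z\<close>; the
    triangle with n then moves the colour to the edge into n.\<close>
  have ex: "\<exists>x. 1 \<le> x \<and> x \<le> k \<and> c x (Suc n) = W \<and> c x n = W" if W: "W \<in> {X, Y}" for W
  proof -
    have "\<not> cut c W 1 (Suc n) n" using no W by blast
    then obtain x j where "1 \<le> x" "x \<le> n" "n < j" "j \<le> Suc n" "c x j = W"
      using kn by (auto simp: cut_def)
    then have x: "1 \<le> x" "x \<le> n" "c x (Suc n) = W" by (auto simp: le_Suc_eq)
    have "x \<le> k" using nZ[of x] x W ne by (cases "k < x") auto
    moreover have "c x n = W"
      using gallaiD[OF g, of x n "Suc n"] x \<open>x \<le> k\<close> kn nZ[of n] W ne by auto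
    ultimately show ?thesis using x by blast
  qed
  obtain x where x: "1 \<le> x" "x \<le> k" "c x n = X" using ex[of X] by auto
  obtain y where y: "1 \<le> y" "y \<le> k" "c y n = Y" using ex[of Y] by auto
  \<comment> \<open>A \<open>Z\<close>-edge inside \<open>{1..k}\<close> joins points that see n in
    the same colour, because edges to n cross the cut and are never \<open>Z\<close>. Hence seeing n
    in colour \<open>X\<close> is a bipartition without \<open>Z\<close>-edges, and x and y lie on
    different sides.\<close>
  have Zc: "c i j \<noteq> Z" if "1 \<le> i" "i < j" "j \<le> k" "(c i n = X) \<noteq> (c j n = X)" for i j
  proof
    assume "c i j = Z"
    then have "c i n = c j n"
      using gallaiD[OF g, of i j n] cutD[OF k, of i n] that kn by auto
    then show False using that by simp
  qed
  have gn: "gallai n c" using g by (auto simp: gallai_def)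
  obtain t where t: "cut c Z 1 k t"
    by (rule split_cut[OF gn, of 1 k x y "\<lambda>i. c i n = X" Z]) (use x y kn ne Zc in auto)
  have "cut c Z 1 n t"
    unfolding cut_def
  proof (intro conjI ballI)
    show "1 \<le> t" "t < n" using t kn by (auto simp: cut_def)
    fix i j assume ij: "i \<in> {1..t}" "j \<in> {t<..n}"
    then show "c i j \<noteq> Z"
    proof (cases "j \<le> k")
      case True then show ?thesis using cutD[OF t] ij by auto
    next
      case False
      have "t < k" using t by (simp add: cut_def)
      then show ?thesis using cutD[OF k] ij False by auto
    qed
  qed
  moreover have "t < k" using t by (simp add: cut_def)
  ultimately show False using least by blast
qed

text \<open>Induction on n, in which the missing colour may change: the colour with a cut at the
  previous stage plays the part of \<open>Z\<close> in the step. Colours other than the three are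
  allowed.\<close>

lemma gallai_cut:
  assumes "2 \<le> n" "gallai n c" "X \<noteq> Y" "X \<noteq> Z" "Y \<noteq> Z"
  shows "\<exists>W\<in>{X, Y, Z}. \<exists>t. cut c W 1 n t"
  using assms(1,2)
proof (induction n rule: dec_induct)
  case base
  have "\<exists>W\<in>{X, Y, Z}. c 1 2 \<noteq> W" using assms(3) by auto
  then obtain W where W: "W \<in> {X, Y, Z}" "c 1 2 \<noteq> W" by blast
  have "c i j \<noteq> W" if "i \<in> {1..1}" "j \<in> {1<..2}" for i j :: nat
  proof -
    have "i = 1" "j = 2" using that by auto
    then show ?thesis using W(2) by simp
  qed
  then have "cut c W 1 2 1" unfolding cut_def by (metis le_refl one_less_numeral_iff semiring_norm(76))
  then show ?case using W by blast
next
  case (step n)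
  have "gallai n c" using step.prems by (auto simp: gallai_def)
  then obtain W t where W: "W \<in> {X, Y, Z}" "cut c W 1 n t" using step.IH by blast
  from W(1) consider "W = X" | "W = Y" | "W = Z" by blast
  then show ?case
  proof cases
    case 1
    have "\<exists>W\<in>{Y, Z, X}. \<exists>t. cut c W 1 (Suc n) t"
      by (rule gallai_cut_step[OF step.prems]) (use W 1 assms in auto)
    then show ?thesis by auto
  next
    case 2
    have "\<exists>W\<in>{X, Z, Y}. \<exists>t. cut c W 1 (Suc n) t"
      by (rule gallai_cut_step[OF step.prems]) (use W 2 assms in auto)
    then show ?thesis by auto
  next
    case 3
    show ?thesis
      by (rule gallai_cut_step[OF step.prems]) (use W 3 assms in auto)
  qed
qed

text \<open>The interval is a shortest one that contains p and q and that no \<open>X\<close>-edge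
  leaves. It has no \<open>X\<close>-cut of its own, and therefore an outside point sees it in one
  colour: two colours would split it without \<open>X\<close>-edges between the two sides.\<close>

lemma gallai_component:
  assumes g: "gallai n c" and X: "cut c X 1 n t0" and pq: "1 \<le> p" "p < q" "q \<le> n" "c p q = X"
  obtains s t where "1 \<le> s" "s \<le> p" "q \<le> t" "t \<le> n" "{s..t} \<noteq> {1..n}"
    "\<And>v x y. 1 \<le> v \<Longrightarrow> v < s \<Longrightarrow> x \<in> {s..t} \<Longrightarrow> y \<in> {s..t} \<Longrightarrow> c v x = c v y"
    "\<And>v x y. t < v \<Longrightarrow> v \<le> n \<Longrightarrow> x \<in> {s..t} \<Longrightarrow> y \<in> {s..t} \<Longrightarrow> c x v = c y v"
proof -
  \<comment> \<open>A cut inside an interval of minimal length with \<open>Q\<close> would produce a shorter one.\<close>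
  define Q where "Q s t \<longleftrightarrow> 1 \<le> s \<and> s \<le> p \<and> q \<le> t \<and> t \<le> n \<and>
    (\<forall>x\<in>{s..t}. (\<forall>v\<in>{1..<s}. c v x \<noteq> X) \<and> (\<forall>v\<in>{t<..n}. c x v \<noteq> X))" for s t
  have "Q 1 n" using pq by (auto simp: Q_def)
  then have "\<exists>l s t. Q s t \<and> t - s = l" by blast
  then obtain l where l: "\<exists>s t. Q s t \<and> t - s = l"
    and least: "\<And>l'. l' < l \<Longrightarrow> \<not> (\<exists>s t. Q s t \<and> t - s = l')"
    using exists_least_iff[of "\<lambda>l. \<exists>s t. Q s t \<and> t - s = l"] by blast
  obtain s t where Q: "Q s t" and st: "t - s = l" using l by blast
  have b: "1 \<le> s" "s \<le> p" "q \<le> t" "t \<le> n"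
    and out: "\<And>x v. x \<in> {s..t} \<Longrightarrow> v \<in> {1..<s} \<Longrightarrow> c v x \<noteq> X"
       "\<And>x v. x \<in> {s..t} \<Longrightarrow> v \<in> {t<..n} \<Longrightarrow> c x v \<noteq> X"
    using Q by (auto simp: Q_def)
  have nocut: "\<not> cut c X s t u" for u
  proof
    assume u: "cut c X s t u"
    then have su: "s \<le> u" "u < t" by (auto simp: cut_def)
    have "\<not> (p \<le> u \<and> u < q)" using cutD[OF u, of p q] b pq by auto
    then consider "q \<le> u" | "u < p" by linarith
    then show False
    proof cases
      case 1
      have "Q s u" unfolding Q_def
      proof (intro conjI ballI)
        fix x v assume x: "x \<in> {s..u}" and v: "v \<in> {u<..n}"
        show "c x v \<noteq> X"
          using cutD[OF u, of x v] out(2)[of x v] x v su by (cases "v \<le> t") auto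
      qed (use b 1 su out(1) in auto)
      moreover have "u - s < l" using su st by linarith
      ultimately show False using least by blast
    next
      case 2
      have "Q (Suc u) t" unfolding Q_def
      proof (intro conjI ballI)
        fix x v assume x: "x \<in> {Suc u..t}" and v: "v \<in> {1..<Suc u}"
        show "c v x \<noteq> X"
          using cutD[OF u, of v x] out(1)[of x v] x v su by (cases "s \<le> v") auto
      qed (use b 2 su out(2) in auto)
      moreover have "t - Suc u < l" using su st by linarith
      ultimately show False using least by blast
    qed
  qed
  show thesis
  proof (rule that)
    \<comment> \<open>The whole set has the cut \<open>t0\<close>, whereas the interval has
      none.\<close>
    show "{s..t} \<noteq> {1..n}"
    proof
      assume "{s..t} = {1..n}"
      then have "s = 1" "t = n" using b pq by (auto simp: Icc_eq_Icc)
      then show False using X nocut by blast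
    qed
  next
    fix v x y assume v: "1 \<le> v" "v < s" and xy: "x \<in> {s..t}" "y \<in> {s..t}"
    show "c v x = c v y"
    proof (rule ccontr)
      assume ne: "c v x \<noteq> c v y"
      \<comment> \<open>If v sees i and j in different colours, the triangle v, i, j gives
        \<open>c v j = c i j\<close>, and this is not \<open>X\<close> because no
        \<open>X\<close>-edge leaves the interval.\<close>
      obtain u where "cut c X s t u"
      proof (rule split_cut[OF g _ _ xy, of "\<lambda>i. c v i = c v x" X])
        fix i j assume ij: "s \<le> i" "i < j" "j \<le> t" "(c v i = c v x) \<noteq> (c v j = c v x)"
        then show "c i j \<noteq> X"
          using gallaiD[OF g, of v i j] out(1)[of j v] v b by auto
      qed (use b ne in auto)
      then show False using nocut by blast
    qed
  next
    fix v x y assume v: "t < v" "v \<le> n" and xy: "x \<in> {s..t}" "y \<in> {s..t}"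
    show "c x v = c y v"
    proof (rule ccontr)
      assume ne: "c x v \<noteq> c y v"
      obtain u where "cut c X s t u"
      proof (rule split_cut[OF g _ _ xy, of "\<lambda>i. c i v = c x v" X])
        fix i j assume ij: "s \<le> i" "i < j" "j \<le> t" "(c i v = c x v) \<noteq> (c j v = c x v)"
        then show "c i j \<noteq> X"
          using gallaiD[OF g, of i j v] out(2)[of i v] v b by auto
      qed (use b ne in auto)
      then show False using nocut by blast
    qed
  qed (use b in auto)
qed

section \<open>Irreducibility as indivisibility into two biclosed sets\<close>

text \<open>Both parts are inversion sets of permutations, so two nonempty parts would form a
  non-trivial decomposition with two members.\<close>

lemma irreducible_permD:
  assumes "irreducible_perm n \<pi>" "\<pi> \<in> perms n"
    and "biclosed n S" "biclosed n T" "S \<inter> T = {}" "Phi n \<pi> = S \<union> T"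
  shows "S = {} \<or> T = {}"
proof (rule ccontr)
  assume ne: "\<not> ?thesis"
  obtain \<sigma> where \<sigma>: "\<sigma> \<in> perms n" "Phi n \<sigma> = S" using biclosed_imp_Phi[OF assms(3)] .
  obtain \<tau> where \<tau>: "\<tau> \<in> perms n" "Phi n \<tau> = T" using biclosed_imp_Phi[OF assms(4)] .
  define \<alpha> where "\<alpha> a = (if a = (1::nat) then \<sigma> else \<tau>)" for a
  have 12: "{1..2} = {1, 2::nat}" by auto
  have "decomposition n (Phi n \<pi>) 2 \<alpha>"
    unfolding decomposition_def 12 using \<sigma> \<tau> assms(5,6)
    by (auto simp: \<alpha>_def disjoint_family_on_def)
  moreover have "\<not> trivial_decomposition n (Phi n \<pi>) 2 \<alpha>"
    unfolding trivial_decomposition_def 12 using \<sigma> \<tau> assms(5,6) ne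
    by (auto simp: \<alpha>_def)
  ultimately show False using assms(1) unfolding irreducible_perm_def reducible_perm_def by blast
qed

text \<open>A decomposition with any number of members reduces to two parts: one nonempty member
  against the union of all others, which is again biclosed. If that union is empty, the chosen
  member is everything.\<close>

lemma irreducible_permI:
  assumes "\<And>S T. biclosed n S \<Longrightarrow> biclosed n T \<Longrightarrow> S \<inter> T = {} \<Longrightarrow> Phi n \<pi> = S \<union> T \<Longrightarrow>
    S = {} \<or> T = {}"
  shows "irreducible_perm n \<pi>"
  unfolding irreducible_perm_def reducible_perm_def
proof (intro notI, elim exE conjE)
  fix r \<alpha> assume dec: "decomposition n (Phi n \<pi>) r \<alpha>"
    and nt: "\<not> trivial_decomposition n (Phi n \<pi>) r \<alpha>"
  have r: "1 \<le> r" and dj: "disjoint_family_on (\<lambda>a. Phi n (\<alpha> a)) {1..r}"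
    and un: "Phi n \<pi> = (\<Union>a\<in>{1..r}. Phi n (\<alpha> a))"
    using dec by (auto simp: decomposition_def)
  have ne: "Phi n \<pi> \<noteq> Phi n (\<alpha> a)" if "a \<in> {1..r}" for a
    using nt dec that by (auto simp: trivial_decomposition_def)
  have "\<exists>a\<in>{1..r}. Phi n (\<alpha> a) \<noteq> {}"
  proof (rule ccontr)
    assume "\<not> ?thesis"
    then have "Phi n \<pi> = Phi n (\<alpha> 1)" using un r by simp
    then show False using ne[of 1] r by simp
  qed
  then obtain a where a: "a \<in> {1..r}" "Phi n (\<alpha> a) \<noteq> {}" by blast
  let ?T = "\<Union>b\<in>{1..r} - {a}. Phi n (\<alpha> b)"
  have "biclosed n ?T"
    by (rule biclosed_UN[OF _ dj]) (use un biclosed_Phi[of n \<pi>] in \<open>auto simp: biclosed_Phi\<close>)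
  moreover have eq: "Phi n \<pi> = Phi n (\<alpha> a) \<union> ?T" using un a by blast
  moreover have "Phi n (\<alpha> a) \<inter> ?T = {}" using dj a unfolding disjoint_family_on_def by fast
  ultimately have "?T = {}" using assms[OF biclosed_Phi[of n "\<alpha> a"], of ?T] a by blast
  then show False using eq ne[OF a(1)] by simp
qed

section \<open>Interval partitions and inflations\<close>

text \<open>On \<open>{1..n}\<close> this is the number of the segment containing x. It encodes the
  partition as a monotone map, so that most arguments about segments need only monotonicity and
  surjectivity onto \<open>{1..m}\<close>.\<close>

definition idx :: "(nat \<Rightarrow> nat) \<Rightarrow> nat \<Rightarrow> nat" where
  "idx z x = (LEAST b. x \<le> sum z {1..b})"

lemma sum_upto_eq: "1 \<le> (b :: nat) \<Longrightarrow> sum z {1..b} = sum z {1..<b} + (z b :: nat)"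
  by (cases b) (simp_all add: atLeastLessThanSuc_atLeastAtMost)

lemma sum_upto_mono: "(i :: nat) \<le> j \<Longrightarrow> sum z {1..i} \<le> (sum z {1..j} :: nat)"
  by (rule sum_mono2) auto

lemma mem_segment: "b \<ge> 1 \<Longrightarrow> x \<in> segment z b \<longleftrightarrow> (\<exists>k\<in>{1..z b}. x = sum z {1..<b} + k)"
proof
  assume b: "b \<ge> 1" and "x \<in> segment z b"
  then have "x - sum z {1..<b} \<in> {1..z b}" "x = sum z {1..<b} + (x - sum z {1..<b})"
    using sum_upto_eq[OF b, of z] by (auto simp: segment_def)
  then show "\<exists>k\<in>{1..z b}. x = sum z {1..<b} + k" by blast
qed (use sum_upto_eq[of b z] in \<open>auto simp: segment_def\<close>)

lemma idx_segment:
  assumes "x \<in> segment z b"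
  shows "idx z x = b"
  unfolding idx_def
proof (rule Least_equality)
  show "x \<le> sum z {1..b}" using assms by (simp add: segment_def)
next
  fix y assume y: "x \<le> sum z {1..y}"
  show "b \<le> y"
  proof (rule ccontr)
    assume "\<not> b \<le> y"
    then have "sum z {1..y} \<le> sum z {1..<b}" by (intro sum_mono2) auto
    then show False using y assms by (simp add: segment_def)
  qed
qed

lemma idx_mono: "x \<le> y \<Longrightarrow> y \<le> sum z {1..m} \<Longrightarrow> idx z x \<le> idx z y"
  unfolding idx_def
  by (rule Least_le) (metis (mono_tags, lifting) LeastI order.trans)

context
  fixes n m :: nat and z :: "nat \<Rightarrow> nat"
  assumes ip: "interval_partition n m z"
begin

lemma sum_z: "sum z {1..m} = n" and z_pos: "b \<in> {1..m} \<Longrightarrow> 1 \<le> z b"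
  using ip by (auto simp: interval_partition_def)

lemma segment_subset:
  assumes "b \<in> {1..m}"
  shows "segment z b \<subseteq> {1..n}"
  using sum_upto_mono[of b m z] assms sum_z by (fastforce simp: segment_def)

lemma idx_mem:
  assumes "x \<in> {1..n}"
  shows "idx z x \<in> {1..m}" "x \<in> segment z (idx z x)"
proof -
  have le: "x \<le> sum z {1..idx z x}"
    unfolding idx_def by (rule LeastI[of _ m]) (use assms sum_z in auto)
  have "idx z x \<le> m"
    unfolding idx_def by (rule Least_le) (use assms sum_z in auto)
  moreover have pos: "idx z x \<noteq> 0" using le assms by (metis atLeastAtMost_iff atLeastatMost_empty
        less_one linorder_not_le sum.empty not_one_le_zero order.trans)
  ultimately show "idx z x \<in> {1..m}" by simp
  have "\<not> x \<le> sum z {1..idx z x - 1}"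
    unfolding idx_def by (rule not_less_Least) (use pos in \<open>simp add: idx_def\<close>)
  moreover have "{1..idx z x - 1} = {1..<idx z x}" using pos by auto
  ultimately show "x \<in> segment z (idx z x)"
    using le by (simp add: segment_def)
qed

lemma segment_nonempty: "b \<in> {1..m} \<Longrightarrow> \<exists>x\<in>{1..n}. idx z x = b"
proof -
  assume b: "b \<in> {1..m}"
  then have "sum z {1..<b} + 1 \<in> segment z b" using z_pos[OF b] by (subst mem_segment) auto
  then show ?thesis using segment_subset[OF b] idx_segment by blast
qed

lemma idx_le: "x \<le> y \<Longrightarrow> y \<in> {1..n} \<Longrightarrow> idx z x \<le> idx z y"
  by (rule idx_mono) (use sum_z in auto)

lemma idx_less: "idx z x < idx z y \<Longrightarrow> x \<in> {1..n} \<Longrightarrow> x < y"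
  using idx_le[of y x] by linarith

lemma idx_offset:
  assumes "b \<in> {1..m}" "k \<in> {1..z b}"
  shows "sum z {1..<b} + k \<in> {1..n}" "idx z (sum z {1..<b} + k) = b"
proof -
  have "sum z {1..<b} + k \<in> segment z b" using assms by (subst mem_segment) auto
  then show "sum z {1..<b} + k \<in> {1..n}" "idx z (sum z {1..<b} + k) = b"
    using segment_subset[OF assms(1)] idx_segment by blast+
qed

lemma offset_ex:
  assumes "x \<in> {1..n}" "idx z x = b"
  obtains k where "k \<in> {1..z b}" "x = sum z {1..<b} + k"
  using idx_mem[OF assms(1)] mem_segment[of b x z] assms(2) by auto

lemma idx_1: "1 \<le> n \<Longrightarrow> idx z 1 = 1"
proof -
  assume "1 \<le> n"
  then have "1 \<in> {1..m}" using idx_mem(1)[of 1] by auto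
  then obtain x where x: "x \<in> {1..n}" "idx z x = 1" using segment_nonempty by blast
  then have "idx z 1 \<le> 1" using idx_le[of 1 x] by auto
  then show ?thesis using idx_mem(1)[of 1] x by auto
qed

lemma idx_n: "1 \<le> n \<Longrightarrow> idx z n = m"
proof -
  assume "1 \<le> n"
  then have "m \<in> {1..m}" using idx_mem(1)[of 1] by auto
  then obtain x where x: "x \<in> {1..n}" "idx z x = m" using segment_nonempty by blast
  then have "m \<le> idx z n" using idx_le[of x n] by auto
  then show ?thesis using idx_mem(1)[of n] x by auto
qed

lemma is_inflation_iff:
  "is_inflation n m z \<sigma> \<beta> \<alpha> \<longleftrightarrow>
     \<sigma> \<in> perms m \<and> (\<forall>b\<in>{1..m}. \<beta> b \<in> perms (z b)) \<and> \<alpha> \<in> perms n \<and>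
     (\<forall>b\<in>{1..m}. \<forall>k\<in>{1..z b}. \<forall>l\<in>{1..z b}.
        \<alpha> (sum z {1..<b} + k) < \<alpha> (sum z {1..<b} + l) \<longleftrightarrow> \<beta> b k < \<beta> b l) \<and>
     (\<forall>x\<in>{1..n}. \<forall>y\<in>{1..n}. idx z x \<noteq> idx z y \<longrightarrow>
        (\<alpha> x < \<alpha> y \<longleftrightarrow> \<sigma> (idx z x) < \<sigma> (idx z y)))"
proof -
  have "(\<forall>i\<in>{1..m}. \<forall>j\<in>{1..m}. i \<noteq> j \<longrightarrow>
        (\<forall>x\<in>segment z i. \<forall>y\<in>segment z j. \<alpha> x < \<alpha> y \<longleftrightarrow> \<sigma> i < \<sigma> j)) \<longleftrightarrow>
     (\<forall>x\<in>{1..n}. \<forall>y\<in>{1..n}. idx z x \<noteq> idx z y \<longrightarrow>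
        (\<alpha> x < \<alpha> y \<longleftrightarrow> \<sigma> (idx z x) < \<sigma> (idx z y)))" (is "?L \<longleftrightarrow> ?R")
  proof
    assume ?L then show ?R using idx_mem by meson
  next
    assume R: ?R
    show ?L
    proof (intro ballI impI)
      fix i j x y assume ij: "i \<in> {1..m}" "j \<in> {1..m}" "i \<noteq> j"
        and x: "x \<in> segment z i" and y: "y \<in> segment z j"
      have "x \<in> {1..n}" "y \<in> {1..n}" using segment_subset ij x y by blast+
      then show "\<alpha> x < \<alpha> y \<longleftrightarrow> \<sigma> i < \<sigma> j"
        using R idx_segment[OF x] idx_segment[OF y] ij(3) by blast
    qed
  qed
  then show ?thesis using ip unfolding is_inflation_def by auto
qed

text \<open>Only the comparisons across segments restrict an inflation; the components are then
  obtained by standardising the values on each segment.\<close>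

lemma inflation_exists:
  assumes "\<sigma> \<in> perms m" "\<alpha> \<in> perms n"
    and cross: "\<And>x y. x \<in> {1..n} \<Longrightarrow> y \<in> {1..n} \<Longrightarrow> idx z x \<noteq> idx z y \<Longrightarrow>
        \<alpha> x < \<alpha> y \<longleftrightarrow> \<sigma> (idx z x) < \<sigma> (idx z y)"
  shows "\<exists>\<beta>. \<beta> \<in> (\<Pi>\<^sub>E b\<in>{1..m}. perms (z b)) \<and> is_inflation n m z \<sigma> \<beta> \<alpha>"
proof -
  have "\<exists>\<gamma>. \<gamma> \<in> perms (z b) \<and> (\<forall>k\<in>{1..z b}. \<forall>l\<in>{1..z b}.
      \<alpha> (sum z {1..<b} + k) < \<alpha> (sum z {1..<b} + l) \<longleftrightarrow> \<gamma> k < \<gamma> l)" for b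
  proof -
    \<comment> \<open>\<open>Phi\<close> is biclosed for every function, so the shifted restriction
      of \<open>\<alpha>\<close> to a segment has the inversions of a genuine permutation of
      \<open>{1..z b}\<close>, its standardisation.\<close>
    let ?f = "\<lambda>k. \<alpha> (sum z {1..<b} + k)"
    obtain \<gamma> where \<gamma>: "\<gamma> \<in> perms (z b)" "Phi (z b) \<gamma> = Phi (z b) ?f"
      using biclosed_imp_Phi[OF biclosed_Phi] .
    have "?f k < ?f l \<longleftrightarrow> \<gamma> k < \<gamma> l" if kl: "k \<in> {1..z b}" "l \<in> {1..z b}" for k l
    proof -
      have eq: "k < l \<Longrightarrow> ?f l < ?f k \<longleftrightarrow> \<gamma> l < \<gamma> k" "l < k \<Longrightarrow> ?f k < ?f l \<longleftrightarrow> \<gamma> k < \<gamma> l"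
        using mem_Phi[of k l "z b" \<gamma>] mem_Phi[of k l "z b" ?f]
          mem_Phi[of l k "z b" \<gamma>] mem_Phi[of l k "z b" ?f] \<gamma>(2) kl by auto
      have ne: "k \<noteq> l \<Longrightarrow> ?f k \<noteq> ?f l \<and> \<gamma> k \<noteq> \<gamma> l"
        using perms_inj[OF assms(2)] perms_inj[OF \<gamma>(1)] by auto
      show ?thesis
      proof (cases k l rule: linorder_cases)
        case less then show ?thesis using eq(1) ne by linarith
      next
        case greater then show ?thesis using eq(2) by blast
      qed simp
    qed
    then show ?thesis using \<gamma>(1) by blast
  qed
  then obtain \<beta> where \<beta>: "\<And>b. \<beta> b \<in> perms (z b)"
    "\<And>b. \<forall>k\<in>{1..z b}. \<forall>l\<in>{1..z b}.
      \<alpha> (sum z {1..<b} + k) < \<alpha> (sum z {1..<b} + l) \<longleftrightarrow> \<beta> b k < \<beta> b l" by metis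
  have "is_inflation n m z \<sigma> (restrict \<beta> {1..m}) \<alpha>"
    unfolding is_inflation_iff using assms \<beta> by simp
  then show ?thesis using \<beta>(1) by (intro exI[of _ "restrict \<beta> {1..m}"]) auto
qed

end

lemma inflation_partition: "is_inflation n m z \<sigma> \<beta> \<alpha> \<Longrightarrow> interval_partition n m z"
  by (simp add: is_inflation_def)

lemma inflation_cross:
  assumes "is_inflation n m z \<sigma> \<beta> \<alpha>" "x \<in> {1..n}" "y \<in> {1..n}" "idx z x \<noteq> idx z y"
  shows "\<alpha> x < \<alpha> y \<longleftrightarrow> \<sigma> (idx z x) < \<sigma> (idx z y)"
  using assms is_inflation_iff[OF inflation_partition[OF assms(1)]] by blast

lemma inflation_inside:
  assumes "is_inflation n m z \<sigma> \<beta> \<alpha>" "b \<in> {1..m}" "k \<in> {1..z b}" "l \<in> {1..z b}"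
  shows "\<alpha> (sum z {1..<b} + k) < \<alpha> (sum z {1..<b} + l) \<longleftrightarrow> \<beta> b k < \<beta> b l"
  using assms by (simp add: is_inflation_def)

lemma inflation_perms:
  assumes "is_inflation n m z \<sigma> \<beta> \<alpha>"
  shows "\<sigma> \<in> perms m" "\<alpha> \<in> perms n" "b \<in> {1..m} \<Longrightarrow> \<beta> b \<in> perms (z b)"
  using assms by (simp_all add: is_inflation_def)

lemma inflation_unique:
  assumes i: "is_inflation n m z \<sigma> \<beta> \<alpha>" "is_inflation n m z \<sigma>' \<beta>' \<alpha>"
  shows "\<sigma> = \<sigma>'" "b \<in> {1..m} \<Longrightarrow> \<beta> b = \<beta>' b"
proof -
  note ip = inflation_partition[OF i(1)]
  show "\<sigma> = \<sigma>'"
  proof (rule perms_eqI[OF inflation_perms(1)[OF i(1)] inflation_perms(1)[OF i(2)]])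
    fix a b assume ab: "a \<in> {1..m}" "b \<in> {1..m}" "a < b"
    obtain x y where "x \<in> {1..n}" "idx z x = a" "y \<in> {1..n}" "idx z y = b"
      using segment_nonempty[OF ip] ab by meson
    then show "\<sigma> a < \<sigma> b \<longleftrightarrow> \<sigma>' a < \<sigma>' b"
      using inflation_cross[OF i(1), of x y] inflation_cross[OF i(2), of x y] ab by auto
  qed
  show "\<beta> b = \<beta>' b" if b: "b \<in> {1..m}"
  proof (rule perms_eqI[OF inflation_perms(3)[OF i(1) b] inflation_perms(3)[OF i(2) b]])
    fix k l assume "k \<in> {1..z b}" "l \<in> {1..z b}"
    then show "\<beta> b k < \<beta> b l \<longleftrightarrow> \<beta>' b k < \<beta>' b l"
      using inflation_inside[OF i(1) b] inflation_inside[OF i(2) b] by blast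
  qed
qed

section \<open>Inflations of simple permutations\<close>

text \<open>The order-theoretic form of a block. Since x and y range over the same interval, the
  implication says that each outside value lies entirely below or entirely above the image, without
  speaking of consecutive values.\<close>

definition interval_module :: "nat \<Rightarrow> (nat \<Rightarrow> nat) \<Rightarrow> nat \<Rightarrow> nat \<Rightarrow> bool" where
  "interval_module n \<alpha> s t \<longleftrightarrow> 1 \<le> s \<and> s \<le> t \<and> t \<le> n \<and>
     (\<forall>v\<in>{1..n} - {s..t}. \<forall>x\<in>{s..t}. \<forall>y\<in>{s..t}. \<alpha> v < \<alpha> x \<longrightarrow> \<alpha> v < \<alpha> y)"

lemma interval_moduleD:
  assumes "interval_module n \<alpha> s t" "v \<in> {1..n}" "v \<notin> {s..t}" "x \<in> {s..t}" "y \<in> {s..t}"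
    and "\<alpha> v < \<alpha> x"
  shows "\<alpha> v < \<alpha> y"
proof -
  have "v \<in> {1..n} - {s..t}" using assms by blast
  then show ?thesis using assms(1,4-) unfolding interval_module_def by blast
qed

text \<open>A value strictly between the minimum and the maximum of the image cannot come from
  outside: being below the maximum, it would have to be below the minimum as well.\<close>

lemma interval_module_block:
  assumes \<alpha>: "\<alpha> \<in> perms n" and K: "interval_module n \<alpha> s t"
  shows "is_block n \<alpha> (t - s + 1) {s..t}"
proof -
  have st: "1 \<le> s" "s \<le> t" "t \<le> n" using K by (auto simp: interval_module_def)
  let ?A = "\<alpha> ` {s..t}"
  have A: "finite ?A" "?A \<noteq> {}" using st by auto
  obtain x where x: "x \<in> {s..t}" "\<alpha> x = Min ?A" using Min_in[OF A] by (rule imageE) simp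
  obtain y where y: "y \<in> {s..t}" "\<alpha> y = Max ?A" using Max_in[OF A] by (rule imageE) simp
  have "{Min ?A..Max ?A} \<subseteq> ?A"
  proof
    fix w assume w: "w \<in> {Min ?A..Max ?A}"
    have "\<alpha> x \<in> {1..n}" "\<alpha> y \<in> {1..n}" using perms_mem[OF \<alpha>] x(1) y(1) st by auto
    then have "w \<in> {1..n}" using w x(2) y(2) by auto
    then have "w \<in> \<alpha> ` {1..n}" using \<alpha> permutes_image[of \<alpha> "{1..n}"] by (simp add: perms_def)
    then obtain v where v: "v \<in> {1..n}" "w = \<alpha> v" by blast
    show "w \<in> ?A"
    proof (cases "v \<in> {s..t}")
      case False
      then have "v \<noteq> y" using y(1) by auto
      then have "\<alpha> v < \<alpha> y" using w v y(2) perms_inj[OF \<alpha>, of v y] by auto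
      then have "\<alpha> v < \<alpha> x" using interval_moduleD[OF K v(1) False y(1) x(1)] by blast
      then show ?thesis using w v x(2) by auto
    qed (use v in auto)
  qed
  then have eq: "?A = {Min ?A..Max ?A}" using A by (auto intro: Min_le Max_ge)
  have "card ?A = t - s + 1"
    using card_image[of \<alpha> "{s..t}"] perms_inj[OF \<alpha>] st by (simp add: inj_on_def)
  moreover have "card ?A = Max ?A - Min ?A + 1"
    using Min_le[OF A(1) Max_in[OF A]] by (subst eq) simp
  ultimately have "Max ?A = Min ?A + (t - s)"
    using Min_le[OF A(1) Max_in[OF A]] by linarith
  then have "?A = {Min ?A..<Min ?A + (t - s + 1)}"
    using eq by (simp only: atLeastLessThanSuc_atLeastAtMost[symmetric] add_Suc_right[symmetric] Suc_eq_plus1[symmetric])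
  moreover have "{s..t} = {s..<s + (t - s + 1)}" using st by auto
  moreover have "{s..t} \<subseteq> {1..n}" using st by auto
  ultimately show ?thesis unfolding is_block_def by blast
qed

lemma simple_module:
  assumes "simple_perm m \<sigma>" "interval_module m \<sigma> s t" "s < t"
  shows "s = 1 \<and> t = m"
proof (rule ccontr)
  assume ne: "\<not> ?thesis"
  have st: "1 \<le> s" "t \<le> m" using assms(2) by (auto simp: interval_module_def)
  have "is_block m \<sigma> (t - s + 1) {s..t}"
    using interval_module_block assms by (simp add: simple_perm_def)
  moreover have "1 < t - s + 1" "t - s + 1 < m" using ne st assms(3) by auto
  ultimately show False using assms(1) unfolding simple_perm_def by blast
qed

text \<open>The segments met by the interval form a module of \<open>\<sigma>\<close> with at least
  two points, hence all of \<open>{1..m}\<close>. If the point 1 were missing from the interval,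
  then segments 2 to m would be a module of \<open>\<sigma>\<close> with m - 1 points, and
  \<open>3 \<le> m\<close> makes this a proper block of size greater than one. The point n is
  treated in the same way.\<close>

lemma inflation_module:
  assumes inf: "is_inflation n m z \<sigma> \<beta> \<alpha>" and \<sigma>: "simple_perm m \<sigma>" and m: "3 \<le> m"
    and K: "interval_module n \<alpha> s t" and ne: "idx z s \<noteq> idx z t"
  shows "s = 1 \<and> t = n"
proof -
  note ip = inflation_partition[OF inf]
  note cross = inflation_cross[OF inf]
  have st: "1 \<le> s" "s \<le> t" "t \<le> n" using K by (auto simp: interval_module_def)
  note mod = interval_moduleD[OF K]
  have lt: "idx z s < idx z t" using idx_le[OF ip, of s t] st ne by auto
  \<comment> \<open>A segment strictly between those of s and t lies completely inside the
    interval.\<close>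
  have rep: "\<exists>y\<in>{s..t}. idx z y = k" if k: "k \<in> {idx z s..idx z t}" for k
  proof (cases "k = idx z s \<or> k = idx z t")
    case True then show ?thesis using st by auto
  next
    case False
    have "k \<in> {1..m}" using k idx_mem(1)[OF ip, of s] idx_mem(1)[OF ip, of t] st by auto
    then obtain y where y: "y \<in> {1..n}" "idx z y = k" using segment_nonempty[OF ip] by blast
    have "s < y" "y < t" using idx_less[OF ip, of s y] idx_less[OF ip, of y t] y k False st by auto
    then show ?thesis using y by auto
  qed
  have "interval_module m \<sigma> (idx z s) (idx z t)"
    unfolding interval_module_def
  proof (intro conjI ballI impI)
    show "1 \<le> idx z s" "idx z t \<le> m" using idx_mem(1)[OF ip, of s] idx_mem(1)[OF ip, of t] st by auto
    fix v a b assume v: "v \<in> {1..m} - {idx z s..idx z t}" and a: "a \<in> {idx z s..idx z t}"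
      and b: "b \<in> {idx z s..idx z t}" and less: "\<sigma> v < \<sigma> a"
    obtain w where w: "w \<in> {1..n}" "idx z w = v" using segment_nonempty[OF ip] v by blast
    obtain x y where x: "x \<in> {s..t}" "idx z x = a" and y: "y \<in> {s..t}" "idx z y = b"
      using rep a b by meson
    have wst: "w \<notin> {s..t}" using idx_le[OF ip, of s w] idx_le[OF ip, of w t] w v st by auto
    have "\<alpha> w < \<alpha> x" using cross[of w x] w x v a less st by auto
    then have "\<alpha> w < \<alpha> y" using mod[OF w(1) wst x(1) y(1)] by blast
    then show "\<sigma> v < \<sigma> b" using cross[of w y] w y v b st by auto
  qed (use lt in simp)
  then have full: "idx z s = 1" "idx z t = m" using simple_module[OF \<sigma>] lt by blast+
  have "s = 1"
  proof (rule ccontr)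
    assume "s \<noteq> 1"
    then have 1: "1 \<in> {1..n}" "1 \<notin> {s..t}" using st by auto
    have i1: "idx z 1 = 1" using idx_1[OF ip] st by auto
    \<comment> \<open>The missing point 1 represents segment 1, while each of the segments 2 to m
      has a representative in the interval, so the module condition at 1 passes to
      \<open>\<sigma>\<close>.\<close>
    have "interval_module m \<sigma> 2 m"
      unfolding interval_module_def
    proof (intro conjI ballI impI)
      fix v a b assume v: "v \<in> {1..m} - {2..m}" and a: "a \<in> {2..m}" and b: "b \<in> {2..m}"
        and less: "\<sigma> v < \<sigma> a"
      have v1: "v = 1" using v by auto
      obtain x y where x: "x \<in> {s..t}" "idx z x = a" and y: "y \<in> {s..t}" "idx z y = b"
        using rep[of a] rep[of b] full a b by force
      have "\<alpha> 1 < \<alpha> x" using cross[of 1 x] i1 x a less st v1 by auto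
      then have "\<alpha> 1 < \<alpha> y" using mod[OF 1 x(1) y(1)] by blast
      then show "\<sigma> v < \<sigma> b" using cross[of 1 y] i1 y b st v1 by auto
    qed (use m in auto)
    then show False using simple_module[OF \<sigma>, of 2 m] m by auto
  qed
  moreover have "t = n"
  proof (rule ccontr)
    assume "t \<noteq> n"
    then have 1: "n \<in> {1..n}" "n \<notin> {s..t}" using st by auto
    have i1: "idx z n = m" using idx_n[OF ip] st by auto
    have "interval_module m \<sigma> 1 (m - 1)"
      unfolding interval_module_def
    proof (intro conjI ballI impI)
      fix v a b assume v: "v \<in> {1..m} - {1..m - 1}" and a: "a \<in> {1..m - 1}" and b: "b \<in> {1..m - 1}"
        and less: "\<sigma> v < \<sigma> a"
      have v1: "v = m" using v by auto
      obtain x y where x: "x \<in> {s..t}" "idx z x = a" and y: "y \<in> {s..t}" "idx z y = b"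
        using rep[of a] rep[of b] full a b by force
      have "\<alpha> n < \<alpha> x" using cross[of n x] i1 x a less st v1 by auto
      then have "\<alpha> n < \<alpha> y" using mod[OF 1 x(1) y(1)] by blast
      then show "\<sigma> v < \<sigma> b" using cross[of n y] i1 y b st v1 by auto
    qed (use m in auto)
    moreover have "1 < m - 1" using m by linarith
    ultimately have "m - 1 = m" using simple_module[OF \<sigma>] by blast
    then show False using m by linarith
  qed
  ultimately show ?thesis by simp
qed

text \<open>The hypothesis says that the pairs across t are all inversions or all non-inversions.
  Then both sides of t are proper interval modules, so each lies in one segment, which leaves no
  room for a third segment.\<close>

lemma simple_inflation_no_cut:
  assumes inf: "is_inflation n m z \<sigma> \<beta> \<alpha>" and \<sigma>: "simple_perm m \<sigma>" and m: "3 \<le> m"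
    and t: "1 \<le> t" "t < n"
    and cut: "\<And>i j k l. i \<in> {1..t} \<Longrightarrow> j \<in> {t<..n} \<Longrightarrow> k \<in> {1..t} \<Longrightarrow> l \<in> {t<..n} \<Longrightarrow>
      \<alpha> j < \<alpha> i \<Longrightarrow> \<alpha> l < \<alpha> k"
  shows False
proof -
  note ip = inflation_partition[OF inf] and \<alpha> = inflation_perms(2)[OF inf]
  have "interval_module n \<alpha> 1 t"
    unfolding interval_module_def
  proof (intro conjI ballI impI)
    fix v x y assume "v \<in> {1..n} - {1..t}" "x \<in> {1..t}" "y \<in> {1..t}" "\<alpha> v < \<alpha> x"
    then show "\<alpha> v < \<alpha> y" using cut[of x v y v] by auto
  qed (use t in auto)
  then have "idx z 1 = idx z t" using inflation_module[OF inf \<sigma> m] t by blast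
  then have t1: "idx z t = 1" using idx_1[OF ip] t by simp
  have "interval_module n \<alpha> (Suc t) n"
    unfolding interval_module_def
  proof (intro conjI ballI impI)
    fix v x y assume v: "v \<in> {1..n} - {Suc t..n}" and xy: "x \<in> {Suc t..n}" "y \<in> {Suc t..n}"
      and less: "\<alpha> v < \<alpha> x"
    have "\<not> \<alpha> y < \<alpha> v" using cut[of v y v x] v xy less by auto
    moreover have "\<alpha> y \<noteq> \<alpha> v" using perms_inj[OF \<alpha>, of y v] v xy by auto
    ultimately show "\<alpha> v < \<alpha> y" by linarith
  qed (use t in auto)
  then have "Suc t = 1 \<or> idx z (Suc t) = idx z n" using inflation_module[OF inf \<sigma> m] by blast
  then have t2: "idx z (Suc t) = m" using idx_n[OF ip] t by simp
  \<comment> \<open>A point of segment 2 fits on neither side: the left side lies in segment 1 and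
    the right side in segment m, with \<open>3 \<le> m\<close>.\<close>
  obtain y where y: "y \<in> {1..n}" "idx z y = 2" using segment_nonempty[OF ip, of 2] m by auto
  then show False using idx_le[OF ip, of y t] idx_le[OF ip, of "Suc t" y] t t1 t2 m
    by (cases "y \<le> t") auto
qed

text \<open>Colour \<open>S\<close> by 1, \<open>T\<close> by 2 and everything else by 0.  A cut for colour 0 contradicts simplicity; a cut
  for the colour of \<open>S\<close> or \<open>T\<close> gives a proper interval block around each pair of that colour.\<close>

lemma split_cross:
  assumes inf: "is_inflation n m z \<sigma> \<beta> \<alpha>" and \<sigma>: "simple_perm m \<sigma>" and m: "3 \<le> m"
    and S: "biclosed n S" and T: "biclosed n T" and ST: "S \<inter> T = {}"
    and un: "S \<union> T = Phi n \<alpha> \<or> S \<union> T = Delta n - Phi n \<alpha>"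
  shows "(\<forall>x y. (x, y) \<in> S \<longrightarrow> idx z x = idx z y) \<or> (\<forall>x y. (x, y) \<in> T \<longrightarrow> idx z x = idx z y)"
proof -
  note ip = inflation_partition[OF inf] and \<alpha> = inflation_perms(2)[OF inf]
  define c :: "nat \<Rightarrow> nat \<Rightarrow> nat" where
    "c i j = (if (i, j) \<in> S then 1 else if (i, j) \<in> T then 2 else 0)" for i j
  \<comment> \<open>Transitivity of the union is what controls colour 0: if a long edge is
    uncoloured, so is one of its short edges.\<close>
  have U: "biclosed n (S \<union> T)"
    using un biclosed_Phi[of n \<alpha>] biclosed_Delta_minus[OF biclosed_Phi[of n \<alpha>]] by metis
  have g: "gallai n c"
    unfolding gallai_def
  proof (intro allI impI)
    fix i j k assume ijk: "1 \<le> i" "i < j" "j < k" "k \<le> n"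
    consider "(i, k) \<in> S" | "(i, k) \<in> T" | "(i, k) \<notin> S \<union> T" by blast
    then show "c i k = c i j \<or> c i k = c j k"
    proof cases
      case 1
      then show ?thesis using biclosedD(3)[OF S ijk(2,3)] by (auto simp: c_def)
    next
      case 2
      then have "(i, j) \<in> T \<or> (j, k) \<in> T" "(i, k) \<notin> S" using biclosedD(3)[OF T ijk(2,3)] ST by auto
      then show ?thesis using 2 ST by (auto simp: c_def)
    next
      case 3
      then have "(i, j) \<notin> S \<union> T \<or> (j, k) \<notin> S \<union> T" using biclosedD(2)[OF U] by blast
      then show ?thesis using 3 by (auto simp: c_def)
    qed
  qed
  have c0: "c i j \<noteq> 0 \<longleftrightarrow> (i, j) \<in> S \<union> T" for i j by (auto simp: c_def)
  \<comment> \<open>Both alternatives for \<open>S \<union> T\<close> are handled at once: nonzero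
    colour means inversion in one case and non-inversion in the other, so pairs that agree on being
    nonzero agree on being inverted.\<close>
  have inv: "\<alpha> j < \<alpha> i \<longleftrightarrow> \<alpha> l < \<alpha> k"
    if "1 \<le> i" "i < j" "j \<le> n" "1 \<le> k" "k < l" "l \<le> n" "c i j \<noteq> 0 \<longleftrightarrow> c k l \<noteq> 0" for i j k l
  proof -
    have "(i, j) \<in> S \<union> T \<longleftrightarrow> (k, l) \<in> S \<union> T" using that(7) unfolding c0 .
    moreover have "(i, j) \<in> Delta n" "(k, l) \<in> Delta n" using that by simp_all
    ultimately have "(i, j) \<in> Phi n \<alpha> \<longleftrightarrow> (k, l) \<in> Phi n \<alpha>" using un by (metis DiffI DiffD2)
    then show ?thesis using that by simp
  qed
  have comp: False if W: "W \<in> {1, 2}" and X: "cut c W 1 n t0" and pq: "1 \<le> p" "p < q" "q \<le> n" "c p q = W"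
    and cr: "idx z p \<noteq> idx z q" for W t0 p q
  proof -
    obtain s t where st: "1 \<le> s" "s \<le> p" "q \<le> t" "t \<le> n" "{s..t} \<noteq> {1..n}"
      and row: "\<And>v x y. 1 \<le> v \<Longrightarrow> v < s \<Longrightarrow> x \<in> {s..t} \<Longrightarrow> y \<in> {s..t} \<Longrightarrow> c v x = c v y"
        "\<And>v x y. t < v \<Longrightarrow> v \<le> n \<Longrightarrow> x \<in> {s..t} \<Longrightarrow> y \<in> {s..t} \<Longrightarrow> c x v = c y v"
      by (rule gallai_component[OF g X pq]) blast
    have "interval_module n \<alpha> s t"
      unfolding interval_module_def
    proof (intro conjI ballI impI)
      fix v x y assume v: "v \<in> {1..n} - {s..t}" and xy: "x \<in> {s..t}" "y \<in> {s..t}" and less: "\<alpha> v < \<alpha> x"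
      show "\<alpha> v < \<alpha> y"
      proof (cases "v < s")
        case True
        then have "\<alpha> x < \<alpha> v \<longleftrightarrow> \<alpha> y < \<alpha> v"
          using inv[of v x v y] row(1)[of v x y] v xy st by auto
        moreover have "\<alpha> y \<noteq> \<alpha> v" using perms_inj[OF \<alpha>, of y v] v xy by auto
        ultimately show ?thesis using less by linarith
      next
        case False
        then show ?thesis
          using inv[of x v y v] row(2)[of v x y] v xy st less by auto
      qed
    qed (use st pq in auto)
    moreover have "idx z s \<noteq> idx z t"
      using idx_le[OF ip, of s p] idx_le[OF ip, of p q] idx_le[OF ip, of q t] st pq cr by auto
    ultimately have "s = 1 \<and> t = n" using inflation_module[OF inf \<sigma> m] by blast
    then show False using st by simp
  qed
  have n: "2 \<le> n"
  proof -
    obtain x y where "x \<in> {1..n}" "idx z x = 1" "y \<in> {1..n}" "idx z y = 2"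
      using segment_nonempty[OF ip, of 1] segment_nonempty[OF ip, of 2] m by auto
    moreover from this have "x \<noteq> y" by auto
    ultimately show ?thesis by auto
  qed
  obtain W t where W: "W \<in> {0, 1, 2}" and cut: "cut c W 1 n t"
    using gallai_cut[OF n g, of 0 1 2] by auto
  consider "W = 0" | "W = 1" | "W = 2" using W by auto
  then show ?thesis
  proof cases
    case 1
    \<comment> \<open>Without colour 0 across t, all pairs across t lie in
      \<open>S \<union> T\<close>, so they are all inversions or all non-inversions.\<close>
    have t: "1 \<le> t" "t < n" using cut by (auto simp: cut_def)
    have False
    proof (rule simple_inflation_no_cut[OF inf \<sigma> m t])
      fix i j k l assume "i \<in> {1..t}" "j \<in> {t<..n}" "k \<in> {1..t}" "l \<in> {t<..n}" "\<alpha> j < \<alpha> i"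
      then show "\<alpha> l < \<alpha> k"
        using inv[of i j k l] cutD[OF cut, of i j] cutD[OF cut, of k l] 1 by auto
    qed
    then show ?thesis ..
  next
    case 2
    have "idx z x = idx z y" if "(x, y) \<in> S" for x y
      using comp[of W t x y] cut 2 biclosedD(1)[OF S that] that by (auto simp: c_def)
    then show ?thesis by blast
  next
    case 3
    have "idx z x = idx z y" if "(x, y) \<in> T" for x y
    proof -
      have "c x y = 2" using that ST by (auto simp: c_def)
      then show ?thesis using comp[of W t x y] cut 3 biclosedD(1)[OF T that] by auto
    qed
    then show ?thesis by blast
  qed
qed

section \<open>Minus-decomposable permutations\<close>

lemma J_perms: "J m \<in> perms m"
proof -
  have "bij_betw (J m) {1..m} {1..m}"
    by (rule bij_betw_byWitness[of _ "J m"]) (auto simp: J_def)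
  then show ?thesis unfolding perms_def mem_Collect_eq by (rule bij_imp_permutes) (auto simp: J_def)
qed

lemma J_less: "i \<in> {1..m} \<Longrightarrow> j \<in> {1..m} \<Longrightarrow> J m i < J m j \<longleftrightarrow> j < i"
  by (auto simp: J_def)

lemma comp_perms: "\<sigma> \<in> perms m \<Longrightarrow> \<tau> \<in> perms m \<Longrightarrow> \<sigma> \<circ> \<tau> \<in> perms m"
  by (simp add: perms_def permutes_compose)

text \<open>Inversion sets only record pairs with x < y. By injectivity a pair that is not inverted
  is strictly increasing, which settles the comparison in both directions.\<close>

lemma cross_order_from_inversions:
  assumes \<alpha>: "\<alpha> \<in> perms n" and \<sigma>: "\<sigma> \<in> perms m" and ip: "interval_partition n m z"
    and inv: "\<And>x y. x \<in> {1..n} \<Longrightarrow> y \<in> {1..n} \<Longrightarrow> x < y \<Longrightarrow> idx z x \<noteq> idx z y \<Longrightarrow>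
      \<alpha> y < \<alpha> x \<longleftrightarrow> \<sigma> (idx z y) < \<sigma> (idx z x)"
    and xy: "x \<in> {1..n}" "y \<in> {1..n}" "idx z x \<noteq> idx z y"
  shows "\<alpha> x < \<alpha> y \<longleftrightarrow> \<sigma> (idx z x) < \<sigma> (idx z y)"
proof -
  have "\<alpha> x \<noteq> \<alpha> y" "\<sigma> (idx z x) \<noteq> \<sigma> (idx z y)"
    using perms_inj[OF \<alpha>, of x y] perms_inj[OF \<sigma>, of "idx z x" "idx z y"] xy by auto
  then show ?thesis using inv[of x y] inv[of y x] xy by (cases x y rule: linorder_cases) auto
qed

lemma minus_decomposable_iff:
  assumes \<alpha>: "\<alpha> \<in> perms n"
  shows "minus_decomposable n \<alpha> \<longleftrightarrow>
    (\<exists>t. 1 \<le> t \<and> t < n \<and> (\<forall>i\<in>{1..t}. \<forall>j\<in>{t<..n}. \<alpha> j < \<alpha> i))"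
proof
  assume "minus_decomposable n \<alpha>"
  then obtain z \<beta> where inf: "is_inflation n 2 z (J 2) \<beta> \<alpha>" by (auto simp: minus_decomposable_def)
  note ip = inflation_partition[OF inf]
  have 12: "{1..2} = {1, 2::nat}" "{1..<2} = {1::nat}" by auto
  have z: "1 \<le> z 1" "1 \<le> z 2" "z 1 + z 2 = n"
    using ip unfolding interval_partition_def 12 by auto
  have seg: "segment z 1 = {0<..z 1}" "segment z 2 = {z 1<..n}"
    using z(3) unfolding segment_def 12 by auto
  have "\<alpha> j < \<alpha> i" if "i \<in> {1..z 1}" "j \<in> {z 1<..n}" for i j
  proof -
    have "idx z i = 1" "idx z j = 2" using idx_segment seg that by auto
    then show ?thesis using inflation_cross[OF inf, of j i] that z by (auto simp: J_def)
  qed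
  then show "\<exists>t. 1 \<le> t \<and> t < n \<and> (\<forall>i\<in>{1..t}. \<forall>j\<in>{t<..n}. \<alpha> j < \<alpha> i)"
    using z by (intro exI[of _ "z 1"]) auto
next
  assume "\<exists>t. 1 \<le> t \<and> t < n \<and> (\<forall>i\<in>{1..t}. \<forall>j\<in>{t<..n}. \<alpha> j < \<alpha> i)"
  then obtain t where t: "1 \<le> t" "t < n" and less: "\<And>i j. i \<in> {1..t} \<Longrightarrow> j \<in> {t<..n} \<Longrightarrow> \<alpha> j < \<alpha> i"
    by blast
  \<comment> \<open>The threshold t becomes the end of the first of two segments.\<close>
  define z where "z b = (if b = (1::nat) then t else n - t)" for b
  have 12: "{1..2} = {1, 2::nat}" "{1..<2} = {1::nat}" by auto
  have ip: "interval_partition n 2 z"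
    using t unfolding interval_partition_def 12 by (auto simp: z_def)
  have seg: "segment z 1 = {0<..t}" "segment z 2 = {t<..n}"
    using t unfolding segment_def 12 by (auto simp: z_def)
  have i1: "idx z x = (if x \<le> t then 1 else 2)" if "x \<in> {1..n}" for x
    using idx_segment[of x z 1] idx_segment[of x z 2] seg that by auto
  have "\<exists>\<beta>. \<beta> \<in> (\<Pi>\<^sub>E b\<in>{1..2}. perms (z b)) \<and> is_inflation n 2 z (J 2) \<beta> \<alpha>"
  proof (rule inflation_exists[OF ip J_perms \<alpha>],
      rule cross_order_from_inversions[OF \<alpha> J_perms ip])
    fix x y assume xy: "x \<in> {1..n}" "y \<in> {1..n}" "x < y" "idx z x \<noteq> idx z y"
    then have "idx z x = 1" "idx z y = 2" "x \<le> t" "\<not> y \<le> t" using i1 by (auto split: if_splits)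
    then show "\<alpha> y < \<alpha> x \<longleftrightarrow> J 2 (idx z y) < J 2 (idx z x)" using less[of x y] xy by (auto simp: J_def)
  qed
  then show "minus_decomposable n \<alpha>" by (auto simp: minus_decomposable_def)
qed

lemma simple_inflation_not_minus_decomposable:
  assumes "is_inflation n m z \<sigma> \<beta> \<alpha>" "simple_perm m \<sigma>" "3 \<le> m"
  shows "\<not> minus_decomposable n \<alpha>"
  using simple_inflation_no_cut[OF assms] minus_decomposable_iff[OF inflation_perms(2)[OF assms(1)]]
  by blast

text \<open>The end of the first segment serves as threshold: every pair across it belongs to
  different segments.\<close>

lemma cross_inversions_minus_decomposable:
  assumes ip: "interval_partition n m z" and m: "2 \<le> m" and \<alpha>: "\<alpha> \<in> perms n"
    and inv: "\<And>x y. x \<in> {1..n} \<Longrightarrow> y \<in> {1..n} \<Longrightarrow> x < y \<Longrightarrow> idx z x \<noteq> idx z y \<Longrightarrow> \<alpha> y < \<alpha> x"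
  shows "minus_decomposable n \<alpha>"
  unfolding minus_decomposable_iff[OF \<alpha>]
proof (intro exI conjI ballI)
  have z: "1 \<le> z 1" using z_pos[OF ip, of 1] m by simp
  have seg: "segment z 1 = {0<..z 1}" by (simp add: segment_def)
  obtain w where w: "w \<in> {1..n}" "idx z w = 2" using segment_nonempty[OF ip, of 2] m by auto
  have "\<not> w \<le> z 1" using idx_segment[of w z 1] seg w by auto
  then show "z 1 < n" using w by auto
  show "1 \<le> z 1" by (rule z)
  fix i j assume i: "i \<in> {1..z 1}" and j: "j \<in> {z 1<..n}"
  have "idx z i = 1" using idx_segment[of i z 1] seg i by auto
  moreover have "idx z j \<noteq> 1" using idx_mem(2)[OF ip, of j] j seg by auto
  ultimately show "\<alpha> j < \<alpha> i" using inv[of i j] i j \<open>z 1 < n\<close> by auto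
qed

section \<open>Decompositions and inflations\<close>

lemma decompositionD:
  assumes "decomposition n A r \<alpha>"
  shows "1 \<le> r" "\<And>a. a \<in> {1..r} \<Longrightarrow> \<alpha> a \<in> perms n"
    "disjoint_family_on (\<lambda>a. Phi n (\<alpha> a)) {1..r}" "A = (\<Union>a\<in>{1..r}. Phi n (\<alpha> a))"
  using assms by (auto simp: decomposition_def)

lemma decomposition_disjoint:
  assumes "decomposition n A r \<alpha>" "a \<in> {1..r}" "b \<in> {1..r}" "p \<in> Phi n (\<alpha> a)" "p \<in> Phi n (\<alpha> b)"
  shows "a = b"
  using decompositionD(3)[OF assms(1)] assms(2-) unfolding disjoint_family_on_def by blast

text \<open>The complement of \<open>Phi n (\<alpha> 1)\<close> is split into one member c and the
  union of the remaining ones. By \<open>split_cross\<close> one part has no pair across segments,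
  and c is chosen so that this must be the other part.\<close>

lemma decomposition_partner:
  assumes dec: "decomposition n (Delta n) r \<alpha>"
    and inf: "is_inflation n m z \<sigma> \<beta> (\<alpha> 1)" and \<sigma>: "simple_perm m \<sigma>" and m: "3 \<le> m"
  obtains c where "c \<in> {2..r}"
    "\<And>x y. 1 \<le> x \<Longrightarrow> x < y \<Longrightarrow> y \<le> n \<Longrightarrow> idx z x \<noteq> idx z y \<Longrightarrow> (x, y) \<notin> Phi n (\<alpha> 1) \<Longrightarrow> (x, y) \<in> Phi n (\<alpha> c)"
proof -
  note ip = inflation_partition[OF inf] and \<alpha> = inflation_perms(2)[OF inf]
  have m2: "2 \<le> m" using m by simp
  \<comment> \<open>If \<open>\<alpha> 1\<close> inverted every pair across segments it would be
    minus-decomposable, which a simple quotient excludes. Whichever member contains a non-inverted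
    cross pair is the partner.\<close>
  have "\<exists>x y. x \<in> {1..n} \<and> y \<in> {1..n} \<and> x < y \<and> idx z x \<noteq> idx z y \<and> \<not> \<alpha> 1 y < \<alpha> 1 x"
    using cross_inversions_minus_decomposable[OF ip m2 \<alpha>]
      simple_inflation_not_minus_decomposable[OF inf \<sigma> m] by blast
  then obtain x0 y0 where xy0: "(x0, y0) \<in> Delta n" "idx z x0 \<noteq> idx z y0" "(x0, y0) \<notin> Phi n (\<alpha> 1)"
    by auto
  obtain c where c: "c \<in> {1..r}" "(x0, y0) \<in> Phi n (\<alpha> c)" using xy0(1) decompositionD(4)[OF dec] by blast
  have c2: "c \<in> {2..r}" using c xy0(3) by (cases "c = 1") auto
  let ?T = "\<Union>a\<in>{2..r} - {c}. Phi n (\<alpha> a)"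
  \<comment> \<open>\<open>Delta n\<close> is biclosed as the complement of the empty set
    \<open>Phi n id\<close>.\<close>
  have "biclosed n (\<Union>a\<in>{1..r}. Phi n (\<alpha> a))"
    using decompositionD(4)[OF dec] biclosed_Delta_minus[OF biclosed_Phi[of n id]]
    by (metis Diff_empty Phi_id)
  then have T: "biclosed n ?T"
    by (rule biclosed_UN[OF _ decompositionD(3)[OF dec]]) (auto simp: biclosed_Phi)
  have r1: "1 \<in> {1..r}" using decompositionD(1)[OF dec] by simp
  have ST: "Phi n (\<alpha> c) \<inter> ?T = {}"
  proof -
    have "c = a" if "a \<in> {2..r}" "p \<in> Phi n (\<alpha> c)" "p \<in> Phi n (\<alpha> a)" for a p
      using decomposition_disjoint[OF dec c(1), of a p] that by simp
    then show ?thesis by blast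
  qed
  have un: "Phi n (\<alpha> c) \<union> ?T = Delta n - Phi n (\<alpha> 1)"
  proof (intro equalityI subsetI)
    fix p assume "p \<in> Phi n (\<alpha> c) \<union> ?T"
    then obtain a where a: "a \<in> {2..r}" "p \<in> Phi n (\<alpha> a)" using c2 by blast
    then have "a \<in> {1..r}" "a \<noteq> 1" by auto
    then have "p \<notin> Phi n (\<alpha> 1)" using decomposition_disjoint[OF dec r1, of a p] a by auto
    then show "p \<in> Delta n - Phi n (\<alpha> 1)" using a Phi_subset_Delta by blast
  next
    fix p assume p: "p \<in> Delta n - Phi n (\<alpha> 1)"
    then obtain a where a: "a \<in> {1..r}" "p \<in> Phi n (\<alpha> a)" using decompositionD(4)[OF dec] by blast
    then have "a \<noteq> 1" using p by auto
    then have "a \<in> {2..r}" using a by auto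
    then show "p \<in> Phi n (\<alpha> c) \<union> ?T" using a by blast
  qed
  have "\<forall>x y. (x, y) \<in> ?T \<longrightarrow> idx z x = idx z y"
    using split_cross[OF inf \<sigma> m biclosed_Phi T ST] un xy0 c by blast
  then have "(x, y) \<in> Phi n (\<alpha> c)"
    if "1 \<le> x" "x < y" "y \<le> n" "idx z x \<noteq> idx z y" "(x, y) \<notin> Phi n (\<alpha> 1)" for x y
  proof -
    have "(x, y) \<in> Phi n (\<alpha> c) \<union> ?T" unfolding un using that by auto
    then show ?thesis using \<open>\<forall>x y. (x, y) \<in> ?T \<longrightarrow> idx z x = idx z y\<close> that(4) by blast
  qed
  then show ?thesis using that c2 by blast
qed

text \<open>Restricting all members to the points of an increasing map keeps the partition of pairs.
  With one representative per segment this yields the quotients, and with the points of one segment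
  the components.\<close>

lemma decomposition_pullback:
  assumes dec: "decomposition n (Delta n) r \<alpha>"
    and \<gamma>: "\<And>a. a \<in> {1..r} \<Longrightarrow> \<gamma> a \<in> perms k"
    and f: "\<And>i. i \<in> {1..k} \<Longrightarrow> f i \<in> {1..n}" "\<And>i j. i \<in> {1..k} \<Longrightarrow> j \<in> {1..k} \<Longrightarrow> i < j \<Longrightarrow> f i < f j"
    and inv: "\<And>a i j. a \<in> {1..r} \<Longrightarrow> i \<in> {1..k} \<Longrightarrow> j \<in> {1..k} \<Longrightarrow> i < j \<Longrightarrow>
      \<gamma> a j < \<gamma> a i \<longleftrightarrow> \<alpha> a (f j) < \<alpha> a (f i)"
  shows "decomposition k (Delta k) r \<gamma>"
proof -
  have iff: "(i, j) \<in> Phi k (\<gamma> a) \<longleftrightarrow> (f i, f j) \<in> Phi n (\<alpha> a)"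
    if "a \<in> {1..r}" "(i, j) \<in> Delta k" for a i j
  proof -
    have "i \<in> {1..k}" "j \<in> {1..k}" "i < j" using that by auto
    then show ?thesis using inv[OF that(1), of i j] f(1)[of i] f(1)[of j] f(2)[of i j] by auto
  qed
  show ?thesis
    unfolding decomposition_def
  proof (intro conjI ballI)
    show "1 \<le> r" by (rule decompositionD(1)[OF dec])
    show "disjoint_family_on (\<lambda>a. Phi k (\<gamma> a)) {1..r}"
      unfolding disjoint_family_on_def
    proof (intro ballI impI)
      fix a b assume ab: "a \<in> {1..r}" "b \<in> {1..r}" "a \<noteq> b"
      have False if "(i, j) \<in> Phi k (\<gamma> a)" "(i, j) \<in> Phi k (\<gamma> b)" for i j
      proof -
        have "(i, j) \<in> Delta k" using that(1) Phi_subset_Delta by blast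
        then show False using decomposition_disjoint[OF dec ab(1,2)] ab(3) that iff[OF ab(1)] iff[OF ab(2)] by blast
      qed
      then show "Phi k (\<gamma> a) \<inter> Phi k (\<gamma> b) = {}" by (auto simp del: mem_Phi)
    qed
    show "Delta k = (\<Union>a\<in>{1..r}. Phi k (\<gamma> a))"
    proof (intro equalityI subrelI)
      fix i j assume ij: "(i, j) \<in> Delta k"
      then have "i \<in> {1..k}" "j \<in> {1..k}" "i < j" by auto
      then have "(f i, f j) \<in> Delta n" using f(1)[of i] f(1)[of j] f(2)[of i j] by auto
      then obtain a where "a \<in> {1..r}" "(f i, f j) \<in> Phi n (\<alpha> a)" using decompositionD(4)[OF dec] by blast
      then show "(i, j) \<in> (\<Union>a\<in>{1..r}. Phi k (\<gamma> a))" using iff ij by blast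
    next
      fix i j assume "(i, j) \<in> (\<Union>a\<in>{1..r}. Phi k (\<gamma> a))"
      then show "(i, j) \<in> Delta k" using Phi_subset_Delta by blast
    qed
  qed (rule \<gamma>)
qed

lemma decomposition_inflation:
  assumes dec: "decomposition n (Delta n) r \<alpha>"
    and inf: "\<And>a. a \<in> {1..r} \<Longrightarrow> is_inflation n m z (\<sigma> a) (\<beta> a) (\<alpha> a)"
  shows "decomposition m (Delta m) r \<sigma>"
    and "b \<in> {1..m} \<Longrightarrow> decomposition (z b) (Delta (z b)) r (\<lambda>a. \<beta> a b)"
proof -
  have r1: "1 \<in> {1..r}" using decompositionD(1)[OF dec] by simp
  note ip = inflation_partition[OF inf[OF r1]]
  obtain f where f: "\<And>b. b \<in> {1..m} \<Longrightarrow> f b \<in> {1..n} \<and> idx z (f b) = b"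
    using segment_nonempty[OF ip] by metis
  show "decomposition m (Delta m) r \<sigma>"
  proof (rule decomposition_pullback[OF dec, of _ _ f])
    fix i j assume ij: "i \<in> {1..m}" "j \<in> {1..m}" "i < j"
    then show "f i < f j" using idx_less[OF ip, of "f i" "f j"] f by simp
    show "\<sigma> a j < \<sigma> a i \<longleftrightarrow> \<alpha> a (f j) < \<alpha> a (f i)" if a: "a \<in> {1..r}" for a
      using inflation_cross[OF inf[OF a], of "f j" "f i"] f ij by simp
  qed (use f inflation_perms(1)[OF inf] in auto)
  show "decomposition (z b) (Delta (z b)) r (\<lambda>a. \<beta> a b)" if b: "b \<in> {1..m}"
  proof (rule decomposition_pullback[OF dec, of _ _ "\<lambda>k. sum z {1..<b} + k"])
    show "\<beta> a b \<in> perms (z b)" if "a \<in> {1..r}" for a by (rule inflation_perms(3)[OF inf[OF that] b])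
    show "sum z {1..<b} + i \<in> {1..n}" if "i \<in> {1..z b}" for i by (rule idx_offset(1)[OF ip b that])
    show "\<beta> a b j < \<beta> a b i \<longleftrightarrow> \<alpha> a (sum z {1..<b} + j) < \<alpha> a (sum z {1..<b} + i)"
      if "a \<in> {1..r}" "i \<in> {1..z b}" "j \<in> {1..z b}" for a i j
      using inflation_inside[OF inf[OF that(1)] b that(3,2)] by simp
  qed simp
qed

section \<open>Reversing the values of a simple permutation\<close>

lemma interval_moduleI_block:
  assumes \<alpha>: "\<alpha> \<in> perms n" and B: "is_block n \<alpha> t B" and t: "1 < t"
  obtains s where "interval_module n \<alpha> s (s + t - 1)"
proof -
  obtain s j where s: "B = {s..<s + t}" and j: "\<alpha> ` B = {j..<j + t}" and sub: "B \<subseteq> {1..n}"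
    using B unfolding is_block_def by blast
  have "{s..<s + t} = {s..s + t - 1}" using t by auto
  then have B': "B = {s..s + t - 1}" using s by simp
  then have "s \<in> B" "s + t - 1 \<in> B" using t by simp_all
  then have st: "s \<in> {1..n}" "s + t - 1 \<in> {1..n}" using sub by blast+
  have "interval_module n \<alpha> s (s + t - 1)"
    unfolding interval_module_def
  proof (intro conjI ballI impI)
    fix v x y assume v: "v \<in> {1..n} - {s..s + t - 1}" and xy: "x \<in> {s..s + t - 1}" "y \<in> {s..s + t - 1}"
      and less: "\<alpha> v < \<alpha> x"
    have "v \<notin> B" using v B' by blast
    then have "\<alpha> v \<notin> \<alpha> ` B" by (simp add: image_iff perms_inj[OF \<alpha>])
    moreover have "\<alpha> x \<in> \<alpha> ` B" "\<alpha> y \<in> \<alpha> ` B" using xy B' by simp_all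
    ultimately show "\<alpha> v < \<alpha> y" using less unfolding j by auto
  qed (use st t in auto)
  then show thesis by (rule that)
qed

text \<open>Reversing the order of values keeps the modules: an outside value above the whole image
  becomes one below it, and conversely.\<close>

lemma simple_perm_J_comp:
  assumes \<sigma>: "simple_perm m \<sigma>"
  shows "simple_perm m (J m \<circ> \<sigma>)"
  unfolding simple_perm_def
proof (intro conjI allI impI notI)
  have p: "\<sigma> \<in> perms m" using \<sigma> by (simp add: simple_perm_def)
  show pJ: "J m \<circ> \<sigma> \<in> perms m" by (rule comp_perms[OF J_perms p])
  fix t assume t: "1 < t \<and> t < m" and "\<exists>B. is_block m (J m \<circ> \<sigma>) t B"
  then obtain B where B: "is_block m (J m \<circ> \<sigma>) t B" by blast
  obtain s where s: "interval_module m (J m \<circ> \<sigma>) s (s + t - 1)"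
    using interval_moduleI_block[OF pJ B conjunct1[OF t]] .
  have b: "1 \<le> s" "s + t - 1 \<le> m" using s by (auto simp: interval_module_def)
  have rev: "J m (\<sigma> x) < J m (\<sigma> y) \<longleftrightarrow> \<sigma> y < \<sigma> x" if "x \<in> {1..m}" "y \<in> {1..m}" for x y
    using J_less[of "\<sigma> x" m "\<sigma> y"] perms_mem[OF p, of x] perms_mem[OF p, of y] that by simp
  have "interval_module m \<sigma> s (s + t - 1)"
    unfolding interval_module_def
  proof (intro conjI ballI impI)
    fix v x y assume v: "v \<in> {1..m} - {s..s + t - 1}" and xy: "x \<in> {s..s + t - 1}" "y \<in> {s..s + t - 1}"
      and less: "\<sigma> v < \<sigma> x"
    have r: "v \<in> {1..m}" "x \<in> {1..m}" "y \<in> {1..m}" using v xy b by auto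
    have "\<not> \<sigma> y < \<sigma> v"
    proof
      assume "\<sigma> y < \<sigma> v"
      then have "(J m \<circ> \<sigma>) v < (J m \<circ> \<sigma>) y" using rev[OF r(1,3)] by simp
      moreover have "v \<notin> {s..s + t - 1}" using v by blast
      ultimately have "(J m \<circ> \<sigma>) v < (J m \<circ> \<sigma>) x" using interval_moduleD[OF s r(1) _ xy(2,1)] by simp
      then show False using rev[OF r(1,2)] less by simp
    qed
    moreover have "\<sigma> y \<noteq> \<sigma> v" using perms_inj[OF p, of y v] v xy by auto
    ultimately show "\<sigma> v < \<sigma> y" by linarith
  qed (use b t in linarith)+
  moreover have "s < s + t - 1" using t by linarith
  ultimately have "s = 1 \<and> s + t - 1 = m" by (rule simple_module[OF \<sigma>])
  then show False using t by linarith
qed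

section \<open>Irreducibility of inflations\<close>

text \<open>This moves a splitting of a component's inversions to the position of its segment, where
  d is the number of points before the segment.\<close>

lemma biclosed_shift:
  assumes S: "biclosed k S" and le: "d + k \<le> n"
  shows "biclosed n {(i, j). d < i \<and> (i - d, j - d) \<in> S}"
proof (rule biclosedI)
  fix i j assume "(i, j) \<in> {(i, j). d < i \<and> (i - d, j - d) \<in> S}"
  then have "d < i" "i - d < j - d" "j - d \<le> k" using biclosedD(1)[OF S, of "i - d" "j - d"] by auto
  then show "1 \<le> i \<and> i < j \<and> j \<le> n" using le by linarith
next
  fix i j l assume "(i, j) \<in> {(i, j). d < i \<and> (i - d, j - d) \<in> S}"
    "(j, l) \<in> {(i, j). d < i \<and> (i - d, j - d) \<in> S}"
  then show "(i, l) \<in> {(i, j). d < i \<and> (i - d, j - d) \<in> S}"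
    using biclosedD(2)[OF S, of "i - d" "j - d" "l - d"] by simp
next
  fix i j l assume ijl: "i < j" "j < l" "(i, l) \<in> {(i, j). d < i \<and> (i - d, j - d) \<in> S}"
  then have "i - d < j - d" "j - d < l - d" by auto
  then show "(i, j) \<in> {(i, j). d < i \<and> (i - d, j - d) \<in> S} \<or>
    (j, l) \<in> {(i, j). d < i \<and> (i - d, j - d) \<in> S}"
    using biclosedD(3)[OF S, of "i - d" "j - d" "l - d"] ijl by simp
qed

lemma biclosed_unshift:
  assumes S: "biclosed n S"
  shows "biclosed k {(i, j) \<in> Delta k. (d + i, d + j) \<in> S}"
proof (rule biclosedI)
  fix i j l assume "(i, j) \<in> {(i, j) \<in> Delta k. (d + i, d + j) \<in> S}"
    "(j, l) \<in> {(i, j) \<in> Delta k. (d + i, d + j) \<in> S}"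
  then show "(i, l) \<in> {(i, j) \<in> Delta k. (d + i, d + j) \<in> S}"
    using biclosedD(2)[OF S, of "d + i" "d + j" "d + l"] by simp
next
  fix i j l assume ijl: "i < j" "j < l" "(i, l) \<in> {(i, j) \<in> Delta k. (d + i, d + j) \<in> S}"
  then show "(i, j) \<in> {(i, j) \<in> Delta k. (d + i, d + j) \<in> S} \<or>
    (j, l) \<in> {(i, j) \<in> Delta k. (d + i, d + j) \<in> S}"
    using biclosedD(3)[OF S, of "d + i" "d + j" "d + l"] by simp
qed simp

lemma irreducible_id: "irreducible_perm k id"
  by (rule irreducible_permI) simp

section \<open>Inversions across segments and inside segments\<close>

context
  fixes n m :: nat and z \<sigma> \<alpha> :: "nat \<Rightarrow> nat" and \<beta> :: "nat \<Rightarrow> nat \<Rightarrow> nat"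
  assumes inf: "is_inflation n m z \<sigma> \<beta> \<alpha>"
begin

private lemmas ip = inflation_partition[OF inf]

lemma inflation_Phi_cross:
  assumes "x \<in> {1..n}" "y \<in> {1..n}" "idx z x < idx z y"
  shows "(x, y) \<in> Phi n \<alpha> \<longleftrightarrow> \<sigma> (idx z y) < \<sigma> (idx z x)"
  using inflation_cross[OF inf, of y x] idx_less[OF ip assms(3,1)] assms by auto

lemma inflation_Phi_inside:
  assumes "b \<in> {1..m}" "(k, l) \<in> Delta (z b)"
  shows "(sum z {1..<b} + k, sum z {1..<b} + l) \<in> Phi n \<alpha> \<longleftrightarrow> (k, l) \<in> Phi (z b) (\<beta> b)"
proof -
  have kl: "k \<in> {1..z b}" "l \<in> {1..z b}" "k < l" using assms(2) by auto
  show ?thesis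
    using inflation_inside[OF inf assms(1) kl(2,1)] idx_offset(1)[OF ip assms(1) kl(1)]
      idx_offset(1)[OF ip assms(1) kl(2)] kl by auto
qed

lemma Phi_in_range: "(i, j) \<in> Phi n \<alpha> \<Longrightarrow> i \<in> {1..n} \<and> j \<in> {1..n} \<and> i < j \<and> idx z i \<le> idx z j"
  using idx_le[OF ip, of i j] by auto

lemma inside_offsets:
  assumes "(i, j) \<in> Phi n \<alpha>" "idx z i = b" "idx z j = b"
  obtains k l where "(k, l) \<in> Phi (z b) (\<beta> b)" "i = sum z {1..<b} + k" "j = sum z {1..<b} + l"
proof -
  have r: "i \<in> {1..n}" "j \<in> {1..n}" "i < j" using Phi_in_range[OF assms(1)] by auto
  have b: "b \<in> {1..m}" using idx_mem(1)[OF ip r(1)] assms(2) by simp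
  obtain k where k: "k \<in> {1..z b}" "i = sum z {1..<b} + k" using offset_ex[OF ip r(1) assms(2)] .
  obtain l where l: "l \<in> {1..z b}" "j = sum z {1..<b} + l" using offset_ex[OF ip r(2) assms(3)] .
  have "(k, l) \<in> Delta (z b)" using k l r by auto
  then have "(k, l) \<in> Phi (z b) (\<beta> b)" using inflation_Phi_inside[OF b] assms(1) k l by metis
  then show thesis using that k l by blast
qed

lemma component_eq_id_iff:
  assumes b: "b \<in> {1..m}"
  shows "\<beta> b = id \<longleftrightarrow> (\<forall>i j. (i, j) \<in> Phi n \<alpha> \<longrightarrow> idx z i = b \<longrightarrow> idx z j \<noteq> b)"
proof
  assume id: "\<beta> b = id"
  show "\<forall>i j. (i, j) \<in> Phi n \<alpha> \<longrightarrow> idx z i = b \<longrightarrow> idx z j \<noteq> b"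
  proof (intro allI impI notI)
    fix i j assume "(i, j) \<in> Phi n \<alpha>" "idx z i = b" "idx z j = b"
    then obtain k l where "(k, l) \<in> Phi (z b) (\<beta> b)" by (rule inside_offsets)
    then show False unfolding id Phi_id by simp
  qed
next
  assume R: "\<forall>i j. (i, j) \<in> Phi n \<alpha> \<longrightarrow> idx z i = b \<longrightarrow> idx z j \<noteq> b"
  have False if kl: "(k, l) \<in> Phi (z b) (\<beta> b)" for k l
  proof -
    have "(k, l) \<in> Delta (z b)" using kl Phi_subset_Delta by blast
    moreover from this have "k \<in> {1..z b}" "l \<in> {1..z b}" by auto
    ultimately show False
      using inflation_Phi_inside[OF b, of k l] kl R idx_offset(2)[OF ip b] by blast
  qed
  then have "Phi (z b) (\<beta> b) = {}" by (auto simp del: mem_Phi)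
  then show "\<beta> b = id" using Phi_empty_iff[OF inflation_perms(3)[OF inf b]] by blast
qed

lemma quotient_eq_id_iff:
  "\<sigma> = id \<longleftrightarrow> (\<forall>i j. (i, j) \<in> Phi n \<alpha> \<longrightarrow> idx z i = idx z j)"
proof
  assume id: "\<sigma> = id"
  show "\<forall>i j. (i, j) \<in> Phi n \<alpha> \<longrightarrow> idx z i = idx z j"
  proof (intro allI impI)
    fix i j assume ij: "(i, j) \<in> Phi n \<alpha>"
    then show "idx z i = idx z j"
      using inflation_Phi_cross[of i j] Phi_in_range[OF ij] id by (cases "idx z i = idx z j") auto
  qed
next
  assume R: "\<forall>i j. (i, j) \<in> Phi n \<alpha> \<longrightarrow> idx z i = idx z j"
  have False if kl: "(k, l) \<in> Phi m \<sigma>" for k l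
  proof -
    have kl': "k \<in> {1..m}" "l \<in> {1..m}" "k < l" "\<sigma> l < \<sigma> k" using kl by auto
    obtain x y where "x \<in> {1..n}" "idx z x = k" "y \<in> {1..n}" "idx z y = l"
      using segment_nonempty[OF ip] kl' by meson
    then have "(x, y) \<in> Phi n \<alpha>" "idx z x \<noteq> idx z y" using inflation_Phi_cross[of x y] kl' by auto
    then show False using R by blast
  qed
  then have "Phi m \<sigma> = {}" by (auto simp del: mem_Phi)
  then show "\<sigma> = id" using Phi_empty_iff[OF inflation_perms(1)[OF inf]] by blast
qed

text \<open>A point between two points of one segment lies in that segment, so both conditions are
  inherited from \<open>Phi n \<alpha>\<close>. The set \<open>B\<close> allows splitting off the
  inversions of selected segments.\<close>

lemma biclosed_inside: "biclosed n {(i, j) \<in> Phi n \<alpha>. idx z i = idx z j \<and> idx z i \<in> B}"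
proof (rule biclosedI)
  fix i j k assume "(i, j) \<in> {(i, j) \<in> Phi n \<alpha>. idx z i = idx z j \<and> idx z i \<in> B}"
    "(j, k) \<in> {(i, j) \<in> Phi n \<alpha>. idx z i = idx z j \<and> idx z i \<in> B}"
  then show "(i, k) \<in> {(i, j) \<in> Phi n \<alpha>. idx z i = idx z j \<and> idx z i \<in> B}"
    using biclosedD(2)[OF biclosed_Phi, of i j n \<alpha> k] by (auto simp del: mem_Phi)
next
  fix i j k :: nat
  assume ijk: "i < j" "j < k" "(i, k) \<in> {(i, j) \<in> Phi n \<alpha>. idx z i = idx z j \<and> idx z i \<in> B}"
  then have ik: "(i, k) \<in> Phi n \<alpha>" "idx z i = idx z k" "idx z i \<in> B" by (auto simp del: mem_Phi)
  have "idx z i \<le> idx z j" "idx z j \<le> idx z k"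
    using idx_le[OF ip, of i j] idx_le[OF ip, of j k] Phi_in_range[OF ik(1)] ijk(1,2) by auto
  then have "idx z j = idx z i" using ik by simp
  moreover have "(i, j) \<in> Phi n \<alpha> \<or> (j, k) \<in> Phi n \<alpha>"
    using biclosedD(3)[OF biclosed_Phi ijk(1,2) ik(1)] .
  ultimately show "(i, j) \<in> {(i, j) \<in> Phi n \<alpha>. idx z i = idx z j \<and> idx z i \<in> B} \<or>
      (j, k) \<in> {(i, j) \<in> Phi n \<alpha>. idx z i = idx z j \<and> idx z i \<in> B}"
    using ik by (auto simp del: mem_Phi)
qed auto

lemma biclosed_cross: "biclosed n {(i, j) \<in> Phi n \<alpha>. idx z i \<noteq> idx z j}"
proof (rule biclosedI)
  fix i j k assume a: "(i, j) \<in> {(i, j) \<in> Phi n \<alpha>. idx z i \<noteq> idx z j}"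
    "(j, k) \<in> {(i, j) \<in> Phi n \<alpha>. idx z i \<noteq> idx z j}"
  then have ij: "(i, j) \<in> Phi n \<alpha>" "(j, k) \<in> Phi n \<alpha>" "idx z i \<noteq> idx z j" by auto
  have "idx z i < idx z k" using Phi_in_range[OF ij(1)] Phi_in_range[OF ij(2)] ij(3) by linarith
  then show "(i, k) \<in> {(i, j) \<in> Phi n \<alpha>. idx z i \<noteq> idx z j}"
    using biclosedD(2)[OF biclosed_Phi ij(1,2)] by (auto simp del: mem_Phi)
next
  fix i j k :: nat
  assume ijk: "i < j" "j < k" "(i, k) \<in> {(i, j) \<in> Phi n \<alpha>. idx z i \<noteq> idx z j}"
  then have ik: "(i, k) \<in> Phi n \<alpha>" "idx z i \<noteq> idx z k" by (auto simp del: mem_Phi)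
  have r: "i \<in> {1..n}" "j \<in> {1..n}" "k \<in> {1..n}" using Phi_in_range[OF ik(1)] ijk(1,2) by auto
  have le: "idx z i \<le> idx z j" "idx z j \<le> idx z k" "idx z i < idx z k"
    using idx_le[OF ip, of i j] idx_le[OF ip, of j k] r ijk(1,2) ik(2) by auto
  have \<sigma>: "\<sigma> (idx z k) < \<sigma> (idx z i)" using inflation_Phi_cross[OF r(1,3) le(3)] ik(1) by blast
  \<comment> \<open>If j shares a segment with an endpoint, the pair formed with the other endpoint
    is governed by the same comparison of \<open>\<sigma>\<close>. Otherwise \<open>\<sigma>\<close>
    at the segment of j cannot be both below and above the two outer values.\<close>
  consider "idx z j = idx z i" | "idx z j = idx z k" | "idx z i < idx z j" "idx z j < idx z k"
    using le by linarith
  then show "(i, j) \<in> {(i, j) \<in> Phi n \<alpha>. idx z i \<noteq> idx z j} \<or>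
      (j, k) \<in> {(i, j) \<in> Phi n \<alpha>. idx z i \<noteq> idx z j}"
  proof cases
    case 1
    then have "(j, k) \<in> Phi n \<alpha>" using inflation_Phi_cross[OF r(2,3)] le \<sigma> by simp
    then show ?thesis using 1 le by (auto simp del: mem_Phi)
  next
    case 2
    then have "(i, j) \<in> Phi n \<alpha>" using inflation_Phi_cross[OF r(1,2)] le \<sigma> by simp
    then show ?thesis using 2 le by (auto simp del: mem_Phi)
  next
    case 3
    have "\<sigma> (idx z k) < \<sigma> (idx z j) \<or> \<sigma> (idx z j) < \<sigma> (idx z i)" using \<sigma> by linarith
    then have "(i, j) \<in> Phi n \<alpha> \<or> (j, k) \<in> Phi n \<alpha>"
      using inflation_Phi_cross[OF r(1,2) 3(1)] inflation_Phi_cross[OF r(2,3) 3(2)] by blast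
    then show ?thesis using 3 by (auto simp del: mem_Phi)
  qed
qed auto

text \<open>The inversions across segments and those inside segments are two biclosed parts of
  \<open>Phi n \<alpha>\<close>; the first is nonempty when \<open>\<sigma>\<close> is not the
  identity.\<close>

lemma irreducible_inflation_components_id:
  assumes irr: "irreducible_perm n \<alpha>" and \<sigma>: "\<sigma> \<noteq> id" and b: "b \<in> {1..m}"
  shows "\<beta> b = id"
proof -
  let ?S = "{(i, j) \<in> Phi n \<alpha>. idx z i \<noteq> idx z j}"
  let ?T = "{(i, j) \<in> Phi n \<alpha>. idx z i = idx z j \<and> idx z i \<in> UNIV}"
  have "?S = {} \<or> ?T = {}"
    by (rule irreducible_permD[OF irr inflation_perms(2)[OF inf] biclosed_cross biclosed_inside])
      (auto simp del: mem_Phi)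
  moreover have "?S \<noteq> {}" using \<sigma> quotient_eq_id_iff by blast
  ultimately have "?T = {}" by blast
  then show ?thesis using component_eq_id_iff[OF b] by blast
qed

text \<open>With the identity as quotient all inversions lie inside segments. Those in the segment
  of i split off from all others, so irreducibility leaves only that segment.\<close>

lemma irreducible_inflation_single:
  assumes irr: "irreducible_perm n \<alpha>" and \<sigma>: "\<sigma> = id" and ij: "(i, j) \<in> Phi n \<alpha>"
    and kl: "(k, l) \<in> Phi n \<alpha>"
  shows "idx z j = idx z i" "idx z k = idx z i" "idx z l = idx z i"
proof -
  have same: "idx z x = idx z y" if "(x, y) \<in> Phi n \<alpha>" for x y
    using that \<sigma> quotient_eq_id_iff by blast
  let ?S = "{(x, y) \<in> Phi n \<alpha>. idx z x = idx z y \<and> idx z x \<in> {idx z i}}"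
  let ?T = "{(x, y) \<in> Phi n \<alpha>. idx z x = idx z y \<and> idx z x \<in> - {idx z i}}"
  have "?S = {} \<or> ?T = {}"
    by (rule irreducible_permD[OF irr inflation_perms(2)[OF inf] biclosed_inside biclosed_inside])
      (use same in \<open>auto simp del: mem_Phi\<close>)
  moreover have "?S \<noteq> {}" using ij same[OF ij] by blast
  ultimately have "?T = {}" by blast
  then show "idx z j = idx z i" "idx z k = idx z i" "idx z l = idx z i"
    using same[OF ij] same[OF kl] kl by (auto simp del: mem_Phi)
qed

lemma irreducible_inflation_unique_component:
  assumes irr: "irreducible_perm n \<alpha>" and \<sigma>: "\<sigma> = id" and ne: "Phi n \<alpha> \<noteq> {}"
  shows "\<exists>!b. b \<in> {1..m} \<and> \<beta> b \<noteq> id"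
proof -
  obtain i j where ij: "(i, j) \<in> Phi n \<alpha>" using ne by (auto simp del: mem_Phi)
  have b: "idx z i \<in> {1..m}" using idx_mem(1)[OF ip] Phi_in_range[OF ij] by blast
  show ?thesis
  proof (rule ex1I[of _ "idx z i"])
    show "idx z i \<in> {1..m} \<and> \<beta> (idx z i) \<noteq> id"
      using b component_eq_id_iff[OF b] ij irreducible_inflation_single(1)[OF irr \<sigma> ij ij] by blast
    fix b' assume b': "b' \<in> {1..m} \<and> \<beta> b' \<noteq> id"
    then obtain k l where "(k, l) \<in> Phi n \<alpha>" "idx z k = b'" using component_eq_id_iff[of b'] by blast
    then show "b' = idx z i" using irreducible_inflation_single(2)[OF irr \<sigma> ij] by blast
  qed
qed

lemma offset_le:
  assumes "b \<in> {1..m}"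
  shows "sum z {1..<b} + z b \<le> n"
  using idx_offset(1)[OF ip assms, of "z b"] z_pos[OF ip assms] by auto

text \<open>A component other than the identity forces \<open>\<sigma> = id\<close> and is then the
  only one with inversions. So \<open>Phi n \<alpha>\<close> is a shifted copy of its inversion set,
  and a splitting of the component would shift to a splitting of \<open>\<alpha>\<close>.\<close>

lemma irreducible_inflation_component:
  assumes irr: "irreducible_perm n \<alpha>" and b: "b \<in> {1..m}"
  shows "irreducible_perm (z b) (\<beta> b)"
proof (cases "\<beta> b = id")
  case True
  then show ?thesis by (simp add: irreducible_id)
next
  case False
  then have \<sigma>: "\<sigma> = id" using irreducible_inflation_components_id[OF irr _ b] by blast
  obtain i j where ij: "(i, j) \<in> Phi n \<alpha>" "idx z i = b" using component_eq_id_iff[OF b] False by blast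
  have all: "idx z x = b" "idx z y = b" if "(x, y) \<in> Phi n \<alpha>" for x y
    using irreducible_inflation_single[OF irr \<sigma> ij(1) that] ij(2) by auto
  let ?d = "sum z {1..<b}"
  let ?sh = "\<lambda>S. {(i, j). ?d < i \<and> (i - ?d, j - ?d) \<in> S}"
  have sh: "p \<in> ?sh (Phi (z b) (\<beta> b))" if p: "p \<in> Phi n \<alpha>" for p
  proof -
    obtain x y where xy: "p = (x, y)" by (cases p)
    then have "(x, y) \<in> Phi n \<alpha>" using p by simp
    then obtain k l where kl: "(k, l) \<in> Phi (z b) (\<beta> b)" "x = ?d + k" "y = ?d + l"
      using inside_offsets[OF _ all] by metis
    then have "1 \<le> k" by simp
    then show ?thesis using kl xy by simp
  qed
  have sh': "p \<in> Phi n \<alpha>" if p: "p \<in> ?sh (Phi (z b) (\<beta> b))" for p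
  proof -
    obtain x y where xy: "p = (x, y)" "?d < x" "(x - ?d, y - ?d) \<in> Phi (z b) (\<beta> b)"
      using p by (cases p) (auto simp del: mem_Phi)
    then have "(x - ?d, y - ?d) \<in> Delta (z b)" using Phi_subset_Delta by blast
    then have "(?d + (x - ?d), ?d + (y - ?d)) \<in> Phi n \<alpha>" using inflation_Phi_inside[OF b] xy by blast
    moreover have "x - ?d < y - ?d" using xy(3) by simp
    then have "?d + (x - ?d) = x" "?d + (y - ?d) = y" using xy(2) by linarith+
    ultimately show ?thesis using xy(1) by metis
  qed
  have eq: "Phi n \<alpha> = ?sh (Phi (z b) (\<beta> b))" using sh sh' by blast
  show ?thesis
  proof (rule irreducible_permI)
    fix S T assume S: "biclosed (z b) S" and T: "biclosed (z b) T" and ST: "S \<inter> T = {}"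
      and un: "Phi (z b) (\<beta> b) = S \<union> T"
    have "?sh S = {} \<or> ?sh T = {}"
    proof (rule irreducible_permD[OF irr inflation_perms(2)[OF inf]])
      show "biclosed n (?sh S)" "biclosed n (?sh T)" using biclosed_shift[OF _ offset_le[OF b]] S T by blast+
      show "?sh S \<inter> ?sh T = {}" using ST by auto
      show "Phi n \<alpha> = ?sh S \<union> ?sh T" unfolding eq un by auto
    qed
    moreover have "(?d + k, ?d + l) \<in> ?sh R" if "biclosed (z b) R" "(k, l) \<in> R" for R k l
      using biclosedD(1)[OF that] that(2) by simp
    ultimately show "S = {} \<or> T = {}" using S T by fast
  qed
qed

text \<open>All inversions lie in segment b. Pulling a splitting back to that segment therefore
  loses no pair, so a nonempty part stays nonempty.\<close>

lemma irreducible_from_component: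
  assumes \<sigma>: "\<sigma> = id" and b: "b \<in> {1..m}" and only: "\<And>b'. b' \<in> {1..m} \<Longrightarrow> b' \<noteq> b \<Longrightarrow> \<beta> b' = id"
    and irr: "irreducible_perm (z b) (\<beta> b)"
  shows "irreducible_perm n \<alpha>"
proof (rule irreducible_permI)
  fix S T assume S: "biclosed n S" and T: "biclosed n T" and ST: "S \<inter> T = {}"
    and un: "Phi n \<alpha> = S \<union> T"
  let ?d = "sum z {1..<b}"
  let ?un = "\<lambda>R. {(i, j) \<in> Delta (z b). (?d + i, ?d + j) \<in> R}"
  have "?un S = {} \<or> ?un T = {}"
  proof (rule irreducible_permD[OF irr inflation_perms(3)[OF inf b] biclosed_unshift[OF S] biclosed_unshift[OF T]])
    show "?un S \<inter> ?un T = {}" using ST by auto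
    show "Phi (z b) (\<beta> b) = ?un S \<union> ?un T"
    proof (intro equalityI subrelI)
      fix k l assume kl: "(k, l) \<in> Phi (z b) (\<beta> b)"
      then have "(k, l) \<in> Delta (z b)" using Phi_subset_Delta by blast
      then show "(k, l) \<in> ?un S \<union> ?un T" using inflation_Phi_inside[OF b] kl un by blast
    next
      fix k l assume "(k, l) \<in> ?un S \<union> ?un T"
      then have "(k, l) \<in> Delta (z b)" "(?d + k, ?d + l) \<in> Phi n \<alpha>" using un by auto
      then show "(k, l) \<in> Phi (z b) (\<beta> b)" using inflation_Phi_inside[OF b] by blast
    qed
  qed
  moreover have "?un R \<noteq> {}" if R: "R \<subseteq> Phi n \<alpha>" "R \<noteq> {}" for R
  proof -
    obtain x y where xy: "(x, y) \<in> R" using R(2) by auto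
    then have xyP: "(x, y) \<in> Phi n \<alpha>" using R(1) by blast
    have eq: "idx z x = idx z y" using xyP \<sigma> quotient_eq_id_iff by blast
    have m: "idx z x \<in> {1..m}" using idx_mem(1)[OF ip] Phi_in_range[OF xyP] by blast
    have "\<beta> (idx z x) \<noteq> id" using component_eq_id_iff[OF m] xyP eq by metis
    then have "idx z x = b" using only m by blast
    then obtain k l where kl: "(k, l) \<in> Phi (z b) (\<beta> b)" "x = ?d + k" "y = ?d + l"
      using inside_offsets[OF xyP] eq by metis
    then have "(k, l) \<in> Delta (z b)" using Phi_subset_Delta by blast
    then have "(k, l) \<in> ?un R" using kl xy by simp
    then show ?thesis by blast
  qed
  ultimately show "S = {} \<or> T = {}" using un by blast
qed

text \<open>With identity components every inversion joins different segments, so the part that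
  \<open>split_cross\<close> confines to the inside of segments is empty.\<close>

lemma irreducible_simple_inflation:
  assumes \<sigma>: "simple_perm m \<sigma>" "3 \<le> m" and \<beta>: "\<And>b. b \<in> {1..m} \<Longrightarrow> \<beta> b = id"
  shows "irreducible_perm n \<alpha>"
proof (rule irreducible_permI)
  fix S T assume S: "biclosed n S" and T: "biclosed n T" and ST: "S \<inter> T = {}"
    and un: "Phi n \<alpha> = S \<union> T"
  have cr: "idx z x \<noteq> idx z y" if "(x, y) \<in> Phi n \<alpha>" for x y
  proof -
    have "idx z x \<in> {1..m}" using idx_mem(1)[OF ip] Phi_in_range[OF that] by blast
    then show ?thesis using component_eq_id_iff \<beta> that by metis
  qed
  have "(\<forall>x y. (x, y) \<in> S \<longrightarrow> idx z x = idx z y) \<or> (\<forall>x y. (x, y) \<in> T \<longrightarrow> idx z x = idx z y)"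
    by (rule split_cross[OF inf \<sigma> S T ST]) (use un in blast)
  then show "S = {} \<or> T = {}" using cr un by (auto simp del: mem_Phi)
qed

lemma irreducible_J_inflation:
  assumes \<sigma>: "\<sigma> = J m" and irr: "irreducible_perm n \<alpha>" and m: "2 \<le> m"
  shows "m = 2"
proof (rule ccontr)
  assume "m \<noteq> 2"
  then have m3: "3 \<le> m" using m by simp
  \<comment> \<open>The pairs starting in the first segment split off.\<close>
  let ?S = "{(i, j) \<in> Phi n \<alpha>. idx z i = 1}" and ?T = "{(i, j) \<in> Phi n \<alpha>. idx z i \<noteq> 1}"
  have cr: "(x, y) \<in> Phi n \<alpha>" if "x \<in> {1..n}" "y \<in> {1..n}" "idx z x < idx z y" for x y
    using inflation_Phi_cross[OF that] idx_mem(1)[OF ip that(1)] idx_mem(1)[OF ip that(2)] that(3)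
      J_less \<sigma> by blast
  have S: "biclosed n ?S"
  proof (rule biclosedI)
    fix i j k assume "(i, j) \<in> ?S" "(j, k) \<in> ?S"
    then show "(i, k) \<in> ?S" using biclosedD(2)[OF biclosed_Phi, of i j n \<alpha> k] by (auto simp del: mem_Phi)
  next
    fix i j k :: nat assume ijk: "i < j" "j < k" "(i, k) \<in> ?S"
    then have ik: "(i, k) \<in> Phi n \<alpha>" "idx z i = 1" by (auto simp del: mem_Phi)
    have r: "i \<in> {1..n}" "j \<in> {1..n}" using Phi_in_range[OF ik(1)] ijk(1,2) by auto
    show "(i, j) \<in> ?S \<or> (j, k) \<in> ?S"
    proof (cases "idx z j = 1")
      case True
      then show ?thesis using biclosedD(3)[OF biclosed_Phi ijk(1,2) ik(1)] ik by (auto simp del: mem_Phi)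
    next
      case False
      then have "idx z i < idx z j" using idx_mem(1)[OF ip r(2)] ik(2) by auto
      then show ?thesis using cr[OF r] ik by (auto simp del: mem_Phi)
    qed
  qed auto
  have T: "biclosed n ?T"
  proof (rule biclosedI)
    fix i j k assume "(i, j) \<in> ?T" "(j, k) \<in> ?T"
    then show "(i, k) \<in> ?T" using biclosedD(2)[OF biclosed_Phi, of i j n \<alpha> k] by (auto simp del: mem_Phi)
  next
    fix i j k :: nat assume ijk: "i < j" "j < k" "(i, k) \<in> ?T"
    then have ik: "(i, k) \<in> Phi n \<alpha>" "idx z i \<noteq> 1" by (auto simp del: mem_Phi)
    have r: "i \<in> {1..n}" "j \<in> {1..n}" using Phi_in_range[OF ik(1)] ijk(1,2) by auto
    have "idx z j \<noteq> 1" using idx_le[OF ip, of i j] r ijk(1) ik(2) idx_mem(1)[OF ip r(1)] by auto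
    then show "(i, j) \<in> ?T \<or> (j, k) \<in> ?T"
      using biclosedD(3)[OF biclosed_Phi ijk(1,2) ik(1)] ik by (auto simp del: mem_Phi)
  qed auto
  have "?S = {} \<or> ?T = {}"
    by (rule irreducible_permD[OF irr inflation_perms(2)[OF inf] S T]) (auto simp del: mem_Phi)
  \<comment> \<open>Points of the first three segments show that both parts are nonempty.\<close>
  moreover obtain x where x: "x \<in> {1..n}" "idx z x = 1" using segment_nonempty[OF ip, of 1] m by auto
  moreover obtain y where y: "y \<in> {1..n}" "idx z y = 2" using segment_nonempty[OF ip, of 2] m by auto
  moreover obtain w where w: "w \<in> {1..n}" "idx z w = 3" using segment_nonempty[OF ip, of 3] m3 by auto
  moreover have "(x, y) \<in> ?S" using cr[OF x(1) y(1)] x(2) y(2) by (simp del: mem_Phi)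
  moreover have "(y, w) \<in> ?T" using cr[OF y(1) w(1)] w(2) y(2) by (simp del: mem_Phi)
  ultimately show False by blast
qed

text \<open>The inversions are exactly the pairs from segment 1 to segment 2. Two such pairs with a
  common endpoint form a triangle whose third side is no inversion, so co-closedness puts them into
  the same part; any two pairs are linked by at most two such moves.\<close>

lemma irreducible_J2_inflation:
  assumes \<sigma>: "\<sigma> = J m" "m = 2" and \<beta>: "\<And>b. b \<in> {1..m} \<Longrightarrow> \<beta> b = id"
  shows "irreducible_perm n \<alpha>"
proof (rule irreducible_permI)
  fix S T assume S: "biclosed n S" and T: "biclosed n T" and ST: "S \<inter> T = {}"
    and un: "Phi n \<alpha> = S \<union> T"
  have cr: "(x, y) \<in> Phi n \<alpha> \<longleftrightarrow> idx z x = 1 \<and> idx z y = 2" if "x \<in> {1..n}" "y \<in> {1..n}" for x y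
  proof -
    have r: "idx z x \<in> {1..m}" "idx z y \<in> {1..m}" using idx_mem(1)[OF ip] that by blast+
    show ?thesis
    proof
      assume xy: "(x, y) \<in> Phi n \<alpha>"
      have "idx z x \<noteq> idx z y" using component_eq_id_iff[OF r(1)] \<beta>[OF r(1)] xy by metis
      then show "idx z x = 1 \<and> idx z y = 2" using Phi_in_range[OF xy] r \<sigma>(2) by auto
    next
      assume "idx z x = 1 \<and> idx z y = 2"
      then show "(x, y) \<in> Phi n \<alpha>" using inflation_Phi_cross[OF that] \<sigma> by (simp add: J_def del: mem_Phi)
    qed
  qed
  have row: "(x', y) \<notin> T" if xy: "(x, y) \<in> S" and x': "x' \<in> {1..n}" "idx z x' = 1" for x x' y
  proof
    assume t: "(x', y) \<in> T"
    have P: "(x, y) \<in> Phi n \<alpha>" "(x', y) \<in> Phi n \<alpha>" using xy t un by auto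
    have r: "x \<in> {1..n}" "y \<in> {1..n}" "x < y" "x' < y" using Phi_in_range[OF P(1)] Phi_in_range[OF P(2)] by auto
    have x1: "idx z x = 1" using cr[OF r(1,2)] P(1) by blast
    have no: "(x, x') \<notin> S \<union> T" "(x', x) \<notin> S \<union> T"
      using cr[OF r(1) x'(1)] cr[OF x'(1) r(1)] x1 x'(2) un by auto
    have "x \<noteq> x'" using xy t ST by auto
    then consider "x < x'" | "x' < x" by linarith
    then show False
    proof cases
      case 1 then show False using biclosedD(3)[OF S 1 r(4) xy] no t ST by blast
    next
      case 2 then show False using biclosedD(3)[OF T 2 r(3) t] no xy ST by blast
    qed
  qed
  have col: "(x, y') \<notin> T" if xy: "(x, y) \<in> S" and y': "y' \<in> {1..n}" "idx z y' = 2" for x y' y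
  proof
    assume t: "(x, y') \<in> T"
    have P: "(x, y) \<in> Phi n \<alpha>" "(x, y') \<in> Phi n \<alpha>" using xy t un by auto
    have r: "x \<in> {1..n}" "y \<in> {1..n}" "x < y" "x < y'" using Phi_in_range[OF P(1)] Phi_in_range[OF P(2)] by auto
    have y1: "idx z y = 2" using cr[OF r(1,2)] P(1) by blast
    have no: "(y, y') \<notin> S \<union> T" "(y', y) \<notin> S \<union> T"
      using cr[OF r(2) y'(1)] cr[OF y'(1) r(2)] y1 y'(2) un by auto
    have "y \<noteq> y'" using xy t ST by auto
    then consider "y < y'" | "y' < y" by linarith
    then show False
    proof cases
      case 1 then show False using biclosedD(3)[OF T r(3) 1 t] no xy ST by blast
    next
      case 2 then show False using biclosedD(3)[OF S r(4) 2 xy] no t ST by blast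
    qed
  qed
  show "S = {} \<or> T = {}"
  proof (rule ccontr)
    assume "\<not> ?thesis"
    then obtain x y x' y' where xy: "(x, y) \<in> S" and t: "(x', y') \<in> T" by auto
    have P: "(x, y) \<in> Phi n \<alpha>" "(x', y') \<in> Phi n \<alpha>" using xy t un by auto
    have r: "x \<in> {1..n}" "y \<in> {1..n}" "x' \<in> {1..n}" "y' \<in> {1..n}"
      using Phi_in_range[OF P(1)] Phi_in_range[OF P(2)] by auto
    have i: "idx z x = 1" "idx z y = 2" "idx z x' = 1" "idx z y' = 2"
      using cr[OF r(1,2)] cr[OF r(3,4)] P by auto
    \<comment> \<open>The pair \<open>(x', y)\<close> shares an endpoint with each of the two given
      pairs.\<close>
    have "(x', y) \<in> S" using row[OF xy r(3) i(3)] cr[OF r(3,2)] i un by blast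
    then show False using col[OF _ r(4) i(4)] t by blast
  qed
qed

end

section \<open>Decompositions of the full inversion set\<close>

text \<open>The points 1 and n lie in the first and the last segment, so their inversion rules out
  the identity as quotient. Minus-decomposability then separates the two remaining forms:
  \<open>J m\<close> inverts all cross pairs, while a simple quotient admits no cut.\<close>

lemma simple_form_cases:
  assumes sf: "simple_form n \<alpha> m z \<sigma> \<beta>" and inv: "(1, n) \<in> Phi n \<alpha>"
  shows "minus_decomposable n \<alpha> \<and> \<sigma> = J m \<or> \<not> minus_decomposable n \<alpha> \<and> simple_perm m \<sigma> \<and> 4 \<le> m"
proof -
  have m: "2 \<le> m" and inf: "is_inflation n m z \<sigma> \<beta> \<alpha>" using sf by (auto simp: simple_form_def)
  note ip = inflation_partition[OF inf]
  have n: "1 < n" "\<alpha> n < \<alpha> 1" using inv by auto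
  have i: "idx z 1 = 1" "idx z n = m" using idx_1[OF ip] idx_n[OF ip] n by simp_all
  then have "\<sigma> \<noteq> id" using inflation_cross[OF inf, of n 1] n m by auto
  then consider "simple_perm m \<sigma>" "4 \<le> m" | "\<sigma> = J m" using sf by (auto simp: simple_form_def)
  then show ?thesis
  proof cases
    case 1
    then have "\<not> minus_decomposable n \<alpha>"
      by (intro simple_inflation_not_minus_decomposable[OF inf]) auto
    then show ?thesis using 1 by blast
  next
    case 2
    have "minus_decomposable n \<alpha>"
    proof (rule cross_inversions_minus_decomposable[OF ip m inflation_perms(2)[OF inf]])
      fix x y assume xy: "x \<in> {1..n}" "y \<in> {1..n}" "x < y" "idx z x \<noteq> idx z y"
      have "idx z x < idx z y" using idx_le[OF ip, of x y] xy by auto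
      then show "\<alpha> y < \<alpha> x"
        using inflation_cross[OF inf xy(2,1)] J_less[OF idx_mem(1)[OF ip xy(2)] idx_mem(1)[OF ip xy(1)]] 2
        by simp
    qed
    then show ?thesis using 2 by blast
  qed
qed

section \<open>Compatible families of inflations: existence and uniqueness\<close>

lemma is_inflation_cong:
  assumes "is_inflation n m z \<sigma> \<beta> \<alpha>" "\<And>b. b \<in> {1..m} \<Longrightarrow> \<beta>' b = \<beta> b"
  shows "is_inflation n m z \<sigma> \<beta>' \<alpha>"
  using assms by (simp add: is_inflation_def)

lemma compatible_inflationsD:
  assumes c: "compatible_inflations n r \<alpha> m z \<sigma>1 \<beta>1 \<sigma> \<beta>"
    and inf1: "is_inflation n m z \<sigma>1 \<beta>1 (\<alpha> 1)" and a: "a \<in> {1..r}"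
  shows "is_inflation n m z (\<sigma> a) (\<beta> a) (\<alpha> a)"
proof (cases "a = 1")
  case True
  have "is_inflation n m z \<sigma>1 (\<beta> 1) (\<alpha> 1)"
    by (rule is_inflation_cong[OF inf1]) (use c in \<open>simp add: compatible_inflations_def\<close>)
  then show ?thesis using True c by (simp add: compatible_inflations_def)
next
  case False
  then have "a \<in> {2..r}" using a by auto
  then show ?thesis using c unfolding compatible_inflations_def by blast
qed

text \<open>It suffices to find quotients \<open>\<tau>\<close> that predict the inversions across
  segments. The components follow from \<open>inflation_exists\<close>, the decompositions of
  quotients and components from restriction to representatives and to segments, and uniqueness from
  \<open>inflation_unique\<close>.\<close>

lemma compatible_inflations_ex1:
  assumes dec: "decomposition n (Delta n) r \<alpha>"
    and inf1: "is_inflation n m z \<sigma>1 \<beta>1 (\<alpha> 1)"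
    and \<tau>1: "\<tau> 1 = \<sigma>1" and \<tau>: "\<And>a. a \<in> {2..r} \<Longrightarrow> \<tau> a \<in> perms m"
    and inv: "\<And>a x y. a \<in> {2..r} \<Longrightarrow> x \<in> {1..n} \<Longrightarrow> y \<in> {1..n} \<Longrightarrow> x < y \<Longrightarrow> idx z x < idx z y \<Longrightarrow>
      \<alpha> a y < \<alpha> a x \<longleftrightarrow> \<tau> a (idx z y) < \<tau> a (idx z x)"
    and minus: "minus_decomposable n (\<alpha> 1) \<longrightarrow> \<tau> 1 = J m \<and> (\<forall>a\<in>{2..r}. \<tau> a = id)"
    and simple: "\<not> minus_decomposable n (\<alpha> 1) \<longrightarrow>
        simple_perm m (\<tau> 1) \<and> 2 \<le> r \<and> \<tau> 2 = J m \<circ> \<tau> 1 \<and> (\<forall>a\<in>{3..r}. \<tau> a = id)"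
  shows "\<exists>!F. compatible_inflations n r \<alpha> m z \<sigma>1 \<beta>1 (fst F) (snd F)"
proof -
  note ip = inflation_partition[OF inf1]
  have r: "1 \<le> r" and \<alpha>: "\<And>a. a \<in> {1..r} \<Longrightarrow> \<alpha> a \<in> perms n" using decompositionD[OF dec] by blast+
  have "\<exists>B. B \<in> (\<Pi>\<^sub>E b\<in>{1..m}. perms (z b)) \<and> is_inflation n m z (\<tau> a) B (\<alpha> a)" if a: "a \<in> {2..r}" for a
  proof (rule inflation_exists[OF ip \<tau>[OF a]])
    show \<alpha>a: "\<alpha> a \<in> perms n" using \<alpha> a by simp
    fix x y assume xy: "x \<in> {1..n}" "y \<in> {1..n}" "idx z x \<noteq> idx z y"
    show "\<alpha> a x < \<alpha> a y \<longleftrightarrow> \<tau> a (idx z x) < \<tau> a (idx z y)"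
    proof (rule cross_order_from_inversions[OF \<alpha>a \<tau>[OF a] ip _ xy])
      fix x y assume xy: "x \<in> {1..n}" "y \<in> {1..n}" "x < y" "idx z x \<noteq> idx z y"
      then have "idx z x < idx z y" using idx_le[OF ip, of x y] by simp
      then show "\<alpha> a y < \<alpha> a x \<longleftrightarrow> \<tau> a (idx z y) < \<tau> a (idx z x)" by (rule inv[OF a xy(1-3)])
    qed
  qed
  then obtain B where B: "\<And>a. a \<in> {2..r} \<Longrightarrow> B a \<in> (\<Pi>\<^sub>E b\<in>{1..m}. perms (z b))"
    "\<And>a. a \<in> {2..r} \<Longrightarrow> is_inflation n m z (\<tau> a) (B a) (\<alpha> a)" by metis
  \<comment> \<open>Values outside the index ranges are set to \<open>undefined\<close>, so that
    agreement on all indices in range becomes equality of families.\<close>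
  define \<sigma> where "\<sigma> = restrict \<tau> {1..r}"
  define \<beta> where "\<beta> = (\<lambda>a\<in>{1..r}. if a = 1 then restrict \<beta>1 {1..m} else B a)"
  have \<sigma>a: "\<sigma> a = \<tau> a" if "a \<in> {1..r}" for a using that by (simp add: \<sigma>_def)
  have \<beta>a: "\<beta> a = B a" if "a \<in> {2..r}" for a using that by (simp add: \<beta>_def)
  have \<beta>1: "\<beta> 1 = restrict \<beta>1 {1..m}" using r by (simp add: \<beta>_def)
  have inf: "is_inflation n m z (\<sigma> a) (\<beta> a) (\<alpha> a)" if a: "a \<in> {1..r}" for a
  proof (cases "a = 1")
    case True
    have "is_inflation n m z \<sigma>1 (\<beta> 1) (\<alpha> 1)"
      by (rule is_inflation_cong[OF inf1]) (use \<beta>1 in simp)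
    then show ?thesis using True \<sigma>a[OF a] \<tau>1 by simp
  next
    case False
    then have "a \<in> {2..r}" using a by auto
    then show ?thesis using B(2) \<sigma>a[OF a] \<beta>a by simp
  qed
  have "compatible_inflations n r \<alpha> m z \<sigma>1 \<beta>1 \<sigma> \<beta>"
    unfolding compatible_inflations_def
  proof (intro conjI ballI)
    show "\<sigma> \<in> {1..r} \<rightarrow>\<^sub>E perms m"
    proof (rule PiE_I)
      show "\<sigma> a \<in> perms m" if "a \<in> {1..r}" for a by (rule inflation_perms(1)[OF inf[OF that]])
    qed (auto simp: \<sigma>_def)
    show "\<beta> \<in> (\<Pi>\<^sub>E a\<in>{1..r}. \<Pi>\<^sub>E b\<in>{1..m}. perms (z b))"
    proof (rule PiE_I)
      fix a assume a: "a \<in> {1..r}"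
      show "\<beta> a \<in> (\<Pi>\<^sub>E b\<in>{1..m}. perms (z b))"
      proof (cases "a = 1")
        case True
        show ?thesis unfolding True \<beta>1 using inflation_perms(3)[OF inf1] by auto
      next
        case False
        then have "a \<in> {2..r}" using a by auto
        then show ?thesis using B(1) \<beta>a by simp
      qed
    qed (auto simp: \<beta>_def)
    show "\<sigma> 1 = \<sigma>1" using \<sigma>a r \<tau>1 by simp
    show "\<beta> 1 b = \<beta>1 b" if "b \<in> {1..m}" for b using that \<beta>1 by simp
    show "is_inflation n m z (\<sigma> a) (\<beta> a) (\<alpha> a)" if "a \<in> {2..r}" for a using inf that by simp
    show "decomposition m (Delta m) r \<sigma>" by (rule decomposition_inflation(1)[OF dec inf])
    show "decomposition (z b) (Delta (z b)) r (\<lambda>a. \<beta> a b)" if "b \<in> {1..m}" for b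
      by (rule decomposition_inflation(2)[OF dec inf that])
    show "minus_decomposable n (\<alpha> 1) \<longrightarrow> \<sigma> 1 = J m \<and> (\<forall>a\<in>{2..r}. \<sigma> a = id)"
      using minus \<sigma>a r by simp
    show "\<not> minus_decomposable n (\<alpha> 1) \<longrightarrow>
        simple_perm m (\<sigma> 1) \<and> 2 \<le> r \<and> \<sigma> 2 = J m \<circ> \<sigma> 1 \<and> (\<forall>a\<in>{3..r}. \<sigma> a = id)"
      using simple \<sigma>a r by simp
  qed
  moreover have "F = (\<sigma>, \<beta>)" if F: "compatible_inflations n r \<alpha> m z \<sigma>1 \<beta>1 (fst F) (snd F)" for F
  proof -
    obtain \<sigma>' \<beta>' where F': "F = (\<sigma>', \<beta>')" by (cases F)
    have c: "compatible_inflations n r \<alpha> m z \<sigma>1 \<beta>1 \<sigma>' \<beta>'" using F F' by simp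
    note inf' = compatible_inflationsD[OF c inf1]
    have "\<sigma>' = \<sigma>"
    proof (rule PiE_ext)
      show "\<sigma>' \<in> {1..r} \<rightarrow>\<^sub>E perms m" using c unfolding compatible_inflations_def by blast
      show "\<sigma> \<in> {1..r} \<rightarrow>\<^sub>E perms m" using \<open>compatible_inflations n r \<alpha> m z \<sigma>1 \<beta>1 \<sigma> \<beta>\<close>
        unfolding compatible_inflations_def by blast
      show "\<sigma>' a = \<sigma> a" if "a \<in> {1..r}" for a by (rule inflation_unique(1)[OF inf' inf]) (rule that)+
    qed
    moreover have "\<beta>' = \<beta>"
    proof (rule PiE_ext)
      show b': "\<beta>' \<in> (\<Pi>\<^sub>E a\<in>{1..r}. \<Pi>\<^sub>E b\<in>{1..m}. perms (z b))"
        using c unfolding compatible_inflations_def by blast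
      show b: "\<beta> \<in> (\<Pi>\<^sub>E a\<in>{1..r}. \<Pi>\<^sub>E b\<in>{1..m}. perms (z b))"
        using \<open>compatible_inflations n r \<alpha> m z \<sigma>1 \<beta>1 \<sigma> \<beta>\<close>
        unfolding compatible_inflations_def by blast
      fix a assume a: "a \<in> {1..r}"
      show "\<beta>' a = \<beta> a"
        by (rule PiE_ext[OF PiE_mem[OF b' a] PiE_mem[OF b a]])
          (rule inflation_unique(2)[OF inf'[OF a] inf[OF a]])
    qed
    ultimately show ?thesis using F' by simp
  qed
  ultimately show ?thesis by (intro ex1I[of _ "(\<sigma>, \<beta>)"]) auto
qed

section \<open>Reordering of decompositions and the irreducibility criterion\<close>

lemma decomposition_permute:
  assumes dec: "decomposition n A r \<alpha>" and p: "p permutes {1..r}"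
  shows "decomposition n A r (\<alpha> \<circ> p)"
proof -
  have img: "p ` {1..r} = {1..r}" by (rule permutes_image[OF p])
  have mem: "p a \<in> {1..r}" if "a \<in> {1..r}" for a using img that by blast
  have inj: "p a = p b \<longleftrightarrow> a = b" for a b using permutes_inj[OF p] by (auto simp: inj_def)
  show ?thesis
    unfolding decomposition_def
  proof (intro conjI ballI)
    show "1 \<le> r" by (rule decompositionD(1)[OF dec])
    show "(\<alpha> \<circ> p) a \<in> perms n" if "a \<in> {1..r}" for a using decompositionD(2)[OF dec mem[OF that]] by simp
    show "disjoint_family_on (\<lambda>a. Phi n ((\<alpha> \<circ> p) a)) {1..r}"
      unfolding disjoint_family_on_def
    proof (intro ballI impI)
      fix a b assume ab: "a \<in> {1..r}" "b \<in> {1..r}" "a \<noteq> b"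
      show "Phi n ((\<alpha> \<circ> p) a) \<inter> Phi n ((\<alpha> \<circ> p) b) = {}"
        using disjoint_family_onD[OF decompositionD(3)[OF dec] mem[OF ab(1)] mem[OF ab(2)]] inj ab(3)
        by simp
    qed
    have "(\<Union>a\<in>{1..r}. Phi n (\<alpha> a)) = (\<Union>a\<in>p ` {1..r}. Phi n (\<alpha> a))" by (simp only: img)
    then show "A = (\<Union>a\<in>{1..r}. Phi n ((\<alpha> \<circ> p) a))"
      using decompositionD(4)[OF dec] by (simp only: image_image o_apply)
  qed
qed

text \<open>Both forms of \<open>\<alpha> 1\<close> are treated together: q counts the members with
  a nontrivial quotient, \<open>C\<close> stands for the extra condition on m, and
  \<open>top\<close> supplies irreducibility of the first q members. For the others, nonempty
  inversion sets guarantee a component different from the identity.\<close>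

lemma irreducible_decomposition_inflation_iff:
  assumes dec: "decomposition n (Delta n) r \<alpha>" and ne: "\<And>a. a \<in> {1..r} \<Longrightarrow> Phi n (\<alpha> a) \<noteq> {}"
    and inf: "\<And>a. a \<in> {1..r} \<Longrightarrow> is_inflation n m z (\<sigma> a) (\<beta> a) (\<alpha> a)"
    and q: "q \<le> r" and \<sigma>: "\<And>a. a \<in> {1..q} \<Longrightarrow> \<sigma> a \<noteq> id" "\<And>a. a \<in> {q + 1..r} \<Longrightarrow> \<sigma> a = id"
    and C: "irreducible_perm n (\<alpha> 1) \<Longrightarrow> C"
    and top: "\<And>a. a \<in> {1..q} \<Longrightarrow> C \<Longrightarrow> \<forall>b\<in>{1..m}. \<beta> a b = id \<Longrightarrow> irreducible_perm n (\<alpha> a)"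
  shows "(\<forall>a\<in>{1..r}. irreducible_perm n (\<alpha> a)) \<longleftrightarrow>
      (\<forall>b\<in>{1..m}. irreducible_decomposition (z b) (Delta (z b)) r (\<lambda>a. \<beta> a b)) \<and>
      (\<forall>a\<in>{q + 1..r}. \<exists>!b. b \<in> {1..m} \<and> \<beta> a b \<noteq> id) \<and>
      (\<forall>a\<in>{1..q}. \<forall>b\<in>{1..m}. \<beta> a b = id) \<and> C" (is "?L \<longleftrightarrow> ?R")
proof
  have r1: "1 \<in> {1..r}" using decompositionD(1)[OF dec] by simp
  assume L: ?L
  show ?R
  proof (intro conjI ballI)
    fix b assume b: "b \<in> {1..m}"
    show "irreducible_decomposition (z b) (Delta (z b)) r (\<lambda>a. \<beta> a b)"
      unfolding irreducible_decomposition_def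
    proof (intro conjI ballI)
      show "decomposition (z b) (Delta (z b)) r (\<lambda>a. \<beta> a b)"
        by (rule decomposition_inflation(2)[OF dec inf b])
      fix a assume a: "a \<in> {1..r}"
      show "irreducible_perm (z b) (\<beta> a b)"
        by (rule irreducible_inflation_component[OF inf[OF a] bspec[OF L a] b])
    qed
  next
    fix a assume a: "a \<in> {q + 1..r}"
    then have a': "a \<in> {1..r}" by simp
    show "\<exists>!b. b \<in> {1..m} \<and> \<beta> a b \<noteq> id"
      by (rule irreducible_inflation_unique_component[OF inf[OF a'] bspec[OF L a'] \<sigma>(2)[OF a] ne[OF a']])
  next
    fix a b assume a: "a \<in> {1..q}" and b: "b \<in> {1..m}"
    then have a': "a \<in> {1..r}" using q by simp
    show "\<beta> a b = id"
      by (rule irreducible_inflation_components_id[OF inf[OF a'] bspec[OF L a'] \<sigma>(1)[OF a] b])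
  next
    show C using C L r1 by blast
  qed
next
  assume R: ?R
  show ?L
  proof
    fix a assume a: "a \<in> {1..r}"
    show "irreducible_perm n (\<alpha> a)"
    proof (cases "a \<le> q")
      case True
      then show ?thesis using top[of a] R a by simp
    next
      case False
      then have aq: "a \<in> {q + 1..r}" using a by simp
      then obtain b where b: "b \<in> {1..m}" and only: "\<And>b'. b' \<in> {1..m} \<Longrightarrow> \<beta> a b' \<noteq> id \<Longrightarrow> b' = b"
        using R by blast
      show ?thesis
      proof (rule irreducible_from_component[OF inf[OF a] \<sigma>(2)[OF aq] b])
        show "irreducible_perm (z b) (\<beta> a b)"
          using R b a unfolding irreducible_decomposition_def by blast
      qed (use only in blast)
    qed
  qed
qed

theorem theorem1p10:
  fixes n r m :: nat
    and \<alpha> :: "nat \<Rightarrow> nat \<Rightarrow> nat"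
    and z \<sigma>1 :: "nat \<Rightarrow> nat"
    and \<beta>1 :: "nat \<Rightarrow> nat \<Rightarrow> nat"
  assumes "2 \<le> n"
    and "decomposition n (Delta n) r \<alpha>"
    and "\<forall>a\<in>{1..r}. Phi n (\<alpha> a) \<noteq> {}"
    and "(1, n) \<in> Phi n (\<alpha> 1)"
    and "simple_form n (\<alpha> 1) m z \<sigma>1 \<beta>1"
  shows
    "(\<exists>p. p permutes {2..r} \<and>
        (\<exists>!F. compatible_inflations n r (\<alpha> \<circ> p) m z \<sigma>1 \<beta>1 (fst F) (snd F))) \<and>
     (\<forall>p \<sigma> \<beta>. p permutes {2..r} \<and> compatible_inflations n r (\<alpha> \<circ> p) m z \<sigma>1 \<beta>1 \<sigma> \<beta> \<longrightarrow>
        \<sigma> 1 \<noteq> id \<and> card {a \<in> {2..r}. \<sigma> a \<noteq> id} \<le> 1 \<and>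
        (let q = card {a \<in> {1..r}. \<sigma> a \<noteq> id} in
           q = (if minus_decomposable n (\<alpha> 1) then 1 else 2) \<and>
           (irreducible_decomposition n (Delta n) r \<alpha> \<longleftrightarrow>
              (\<forall>b\<in>{1..m}. irreducible_decomposition (z b) (Delta (z b)) r (\<lambda>a. \<beta> a b)) \<and>
              (\<forall>a\<in>{q + 1..r}. \<exists>!b. b \<in> {1..m} \<and> \<beta> a b \<noteq> id) \<and>
              (\<forall>a\<in>{1..q}. \<forall>b\<in>{1..m}. \<beta> a b = id) \<and>
              (minus_decomposable n (\<alpha> 1) \<longrightarrow> m = 2))))"
proof -
  note dec = assms(2) and sf = assms(5)
  have m: "2 \<le> m" and inf1: "is_inflation n m z \<sigma>1 \<beta>1 (\<alpha> 1)" using sf by (auto simp: simple_form_def)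
  note ip = inflation_partition[OF inf1] and cases = simple_form_cases[OF sf assms(4)]
  have r: "1 \<le> r" by (rule decompositionD(1)[OF dec])
  have perm1: "p permutes {1..r}" "p 1 = 1" if "p permutes {2..r}" for p
    using permutes_subset[OF that, of "{1..r}"] permutes_not_in[OF that, of 1] by auto
  have cov: "(x, y) \<in> Phi n (\<alpha>' a) \<longrightarrow> (x, y) \<notin> Phi n (\<alpha>' b)"
    if "decomposition n (Delta n) r \<alpha>'" "a \<in> {1..r}" "b \<in> {1..r}" "a \<noteq> b" for \<alpha>' a b x y
    using decomposition_disjoint[OF that(1-3)] that(4) by blast
  have "\<exists>p. p permutes {2..r} \<and>
      (\<exists>!F. compatible_inflations n r (\<alpha> \<circ> p) m z \<sigma>1 \<beta>1 (fst F) (snd F))"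
  proof (cases "minus_decomposable n (\<alpha> 1)")
    case True
    then have \<sigma>1: "\<sigma>1 = J m" using cases by blast
    \<comment> \<open>\<open>J m\<close> inverts all pairs of segments, so every cross pair already
      belongs to \<open>Phi n (\<alpha> 1)\<close>. By disjointness the other members have none, and
      the given order can be kept.\<close>
    define \<tau> where "\<tau> a = (if a = (1::nat) then J m else id)" for a
    have "\<exists>!F. compatible_inflations n r \<alpha> m z \<sigma>1 \<beta>1 (fst F) (snd F)"
    proof (rule compatible_inflations_ex1[OF dec inf1, of \<tau>])
      fix a x y assume a: "a \<in> {2..r}" and xy: "x \<in> {1..n}" "y \<in> {1..n}" "x < y" "idx z x < idx z y"
      have "(x, y) \<in> Phi n (\<alpha> 1)"
        using inflation_Phi_cross[OF inf1 xy(1,2,4)] J_less idx_mem(1)[OF ip] xy \<sigma>1 by blast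
      then have "(x, y) \<notin> Phi n (\<alpha> a)" using cov[OF dec, of 1 a] a by simp
      then show "\<alpha> a y < \<alpha> a x \<longleftrightarrow> \<tau> a (idx z y) < \<tau> a (idx z x)" using xy a by (simp add: \<tau>_def)
    qed (use True \<sigma>1 in \<open>auto simp: \<tau>_def\<close>)
    then show ?thesis by (intro exI[of _ id]) (simp add: permutes_id)
  next
    case False
    then have s: "simple_perm m \<sigma>1" "4 \<le> m" using cases by blast+
    then have \<sigma>1: "\<sigma>1 \<in> perms m" by (simp add: simple_perm_def)
    obtain c where c: "c \<in> {2..r}" and partner: "\<And>x y. 1 \<le> x \<Longrightarrow> x < y \<Longrightarrow> y \<le> n \<Longrightarrow> idx z x \<noteq> idx z y \<Longrightarrow>
        (x, y) \<notin> Phi n (\<alpha> 1) \<Longrightarrow> (x, y) \<in> Phi n (\<alpha> c)"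
      by (rule decomposition_partner[OF dec inf1 s(1)]) (use s(2) in auto)
    \<comment> \<open>The partner moves to place 2; for c = 2 this is the identity.\<close>
    define p where "p = Transposition.transpose 2 c"
    have p: "p permutes {2..r}" unfolding p_def by (rule permutes_swap_id) (use c in auto)
    have p1: "(\<alpha> \<circ> p) 1 = \<alpha> 1" using perm1(2)[OF p] by simp
    have p2: "(\<alpha> \<circ> p) 2 = \<alpha> c" by (simp add: p_def)
    have r2: "2 \<le> r" using c by simp
    have dec': "decomposition n (Delta n) r (\<alpha> \<circ> p)" by (rule decomposition_permute[OF dec perm1(1)[OF p]])
    \<comment> \<open>Across segments the partner inverts exactly the pairs that
      \<open>\<alpha> 1\<close> does not, and reversing the values of \<open>\<sigma>1\<close>
      describes just these.\<close>
    define \<tau> where "\<tau> a = (if a = (1::nat) then \<sigma>1 else if a = 2 then J m \<circ> \<sigma>1 else id)" for a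
    have "\<exists>!F. compatible_inflations n r (\<alpha> \<circ> p) m z \<sigma>1 \<beta>1 (fst F) (snd F)"
    proof (rule compatible_inflations_ex1[OF dec', of _ _ _ _ \<tau>])
      show "is_inflation n m z \<sigma>1 \<beta>1 ((\<alpha> \<circ> p) 1)" using inf1 p1 by simp
      show "\<tau> 1 = \<sigma>1" by (simp add: \<tau>_def)
      show "\<tau> a \<in> perms m" for a using \<sigma>1 comp_perms[OF J_perms \<sigma>1] by (simp add: \<tau>_def)
      show "minus_decomposable n ((\<alpha> \<circ> p) 1) \<longrightarrow> \<tau> 1 = J m \<and> (\<forall>a\<in>{2..r}. \<tau> a = id)"
        using False p1 by simp
      show "\<not> minus_decomposable n ((\<alpha> \<circ> p) 1) \<longrightarrow>
        simple_perm m (\<tau> 1) \<and> 2 \<le> r \<and> \<tau> 2 = J m \<circ> \<tau> 1 \<and> (\<forall>a\<in>{3..r}. \<tau> a = id)"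
        using s r2 by (simp add: \<tau>_def)
      fix a x y assume a: "a \<in> {2..r}" and xy: "x \<in> {1..n}" "y \<in> {1..n}" "x < y" "idx z x < idx z y"
      have one: "(x, y) \<in> Phi n (\<alpha> 1) \<longleftrightarrow> \<sigma>1 (idx z y) < \<sigma>1 (idx z x)"
        by (rule inflation_Phi_cross[OF inf1 xy(1,2,4)])
      have two: "(x, y) \<in> Phi n ((\<alpha> \<circ> p) 2) \<longleftrightarrow> (x, y) \<notin> Phi n (\<alpha> 1)"
        using partner[of x y] xy cov[OF dec', of 1 2 x y] r2 p1 p2 by (auto simp del: mem_Phi)
      have mem: "\<sigma>1 (idx z x) \<in> {1..m}" "\<sigma>1 (idx z y) \<in> {1..m}"
        using perms_mem[OF \<sigma>1, of "idx z x"] perms_mem[OF \<sigma>1, of "idx z y"]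
          idx_mem(1)[OF ip xy(1)] idx_mem(1)[OF ip xy(2)] by blast+
      have "\<sigma>1 (idx z x) \<noteq> \<sigma>1 (idx z y)" using perms_inj[OF \<sigma>1, of "idx z x" "idx z y"] xy(4) by simp
      then have J: "J m (\<sigma>1 (idx z y)) < J m (\<sigma>1 (idx z x)) \<longleftrightarrow> \<not> \<sigma>1 (idx z y) < \<sigma>1 (idx z x)"
        using J_less[OF mem(2,1)] by linarith
      have "(x, y) \<in> Phi n ((\<alpha> \<circ> p) a) \<longleftrightarrow> \<tau> a (idx z y) < \<tau> a (idx z x)"
      proof (cases "a = 2")
        case True
        then show ?thesis using one two J by (simp add: \<tau>_def del: mem_Phi)
      next
        case False
        then have "(x, y) \<notin> Phi n ((\<alpha> \<circ> p) a)"
          using cov[OF dec', of 1 a x y] cov[OF dec', of 2 a x y] a r2 two p1 by (auto simp del: mem_Phi)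
        then show ?thesis using False a xy(4) by (simp add: \<tau>_def del: mem_Phi)
      qed
      then show "(\<alpha> \<circ> p) a y < (\<alpha> \<circ> p) a x \<longleftrightarrow> \<tau> a (idx z y) < \<tau> a (idx z x)" using xy by simp
    qed
    then show ?thesis using p by blast
  qed
  moreover have "\<sigma> 1 \<noteq> id \<and> card {a \<in> {2..r}. \<sigma> a \<noteq> id} \<le> 1 \<and>
        (let q = card {a \<in> {1..r}. \<sigma> a \<noteq> id} in
           q = (if minus_decomposable n (\<alpha> 1) then 1 else 2) \<and>
           (irreducible_decomposition n (Delta n) r \<alpha> \<longleftrightarrow>
              (\<forall>b\<in>{1..m}. irreducible_decomposition (z b) (Delta (z b)) r (\<lambda>a. \<beta> a b)) \<and>
              (\<forall>a\<in>{q + 1..r}. \<exists>!b. b \<in> {1..m} \<and> \<beta> a b \<noteq> id) \<and>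
              (\<forall>a\<in>{1..q}. \<forall>b\<in>{1..m}. \<beta> a b = id) \<and>
              (minus_decomposable n (\<alpha> 1) \<longrightarrow> m = 2)))"
    if p: "p permutes {2..r}" and c: "compatible_inflations n r (\<alpha> \<circ> p) m z \<sigma>1 \<beta>1 \<sigma> \<beta>" for p \<sigma> \<beta>
  proof -
    let ?q = "if minus_decomposable n (\<alpha> 1) then 1 else 2 :: nat"
    have p1: "(\<alpha> \<circ> p) 1 = \<alpha> 1" using perm1(2)[OF p] by simp
    have dec': "decomposition n (Delta n) r (\<alpha> \<circ> p)" by (rule decomposition_permute[OF dec perm1(1)[OF p]])
    have pr: "p ` {1..r} = {1..r}" by (rule permutes_image[OF perm1(1)[OF p]])
    have inf1': "is_inflation n m z \<sigma>1 \<beta>1 ((\<alpha> \<circ> p) 1)" using inf1 p1 by simp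
    note inf = compatible_inflationsD[OF c inf1']
    have minus: "\<sigma> 1 = J m \<and> (\<forall>a\<in>{2..r}. \<sigma> a = id)" if "minus_decomposable n (\<alpha> 1)"
    proof -
      have "minus_decomposable n ((\<alpha> \<circ> p) 1)" using that p1 by simp
      then show ?thesis using c unfolding compatible_inflations_def by blast
    qed
    have simple: "simple_perm m (\<sigma> 1) \<and> 4 \<le> m \<and> 2 \<le> r \<and> \<sigma> 2 = J m \<circ> \<sigma> 1 \<and> (\<forall>a\<in>{3..r}. \<sigma> a = id)"
      if nm: "\<not> minus_decomposable n (\<alpha> 1)"
    proof -
      have "\<not> minus_decomposable n ((\<alpha> \<circ> p) 1)" using nm p1 by simp
      moreover have "4 \<le> m" using cases nm by blast
      ultimately show ?thesis using c unfolding compatible_inflations_def by blast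
    qed
    have r1: "1 \<in> {1..r}" using r by simp
    \<comment> \<open>The identity as quotient would confine the inversion \<open>(1, n)\<close> to
      one segment, but its endpoints lie in segments 1 and m with \<open>2 \<le> m\<close>.\<close>
    have \<sigma>1: "\<sigma> 1 \<noteq> id"
    proof
      assume "\<sigma> 1 = id"
      then have "idx z 1 = idx z n"
        using quotient_eq_id_iff[OF inf[OF r1]] assms(4) unfolding p1 by blast
      then show False using idx_1[OF ip] idx_n[OF ip] assms(1) m by simp
    qed
    \<comment> \<open>Otherwise the identity, equal to the reversal of the simple
      \<open>\<sigma> 1\<close>, would be simple, although it has the block {1, 2} and
      \<open>4 \<le> m\<close>.\<close>
    have \<sigma>2: "\<sigma> 2 \<noteq> id" if nm: "\<not> minus_decomposable n (\<alpha> 1)"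
    proof
      assume "\<sigma> 2 = id"
      then have id: "J m \<circ> \<sigma> 1 = id" using simple[OF nm] by simp
      have "simple_perm m (J m \<circ> \<sigma> 1)" by (rule simple_perm_J_comp) (use simple[OF nm] in blast)
      then have s: "simple_perm m id" unfolding id .
      have "is_block m id 2 {1..<1 + 2}"
        unfolding is_block_def using simple[OF nm] by (intro conjI exI[of _ 1]) auto
      moreover have "1 < (2::nat) \<and> 2 < m" using simple[OF nm] by simp
      ultimately show False using s unfolding simple_perm_def by blast
    qed
    have q: "?q \<le> r" using r simple by auto
    have top: "\<sigma> a \<noteq> id" if "a \<in> {1..?q}" for a
    proof -
      have "a = 1 \<or> \<not> minus_decomposable n (\<alpha> 1) \<and> a = 2" using that by (auto split: if_splits)
      then show ?thesis using \<sigma>1 \<sigma>2 by blast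
    qed
    have bot: "\<sigma> a = id" if "a \<in> {?q + 1..r}" for a
      using that minus simple by (auto split: if_splits)
    \<comment> \<open>The nontrivial quotients occupy an initial range of indices, so their number
      also marks the place where the identity quotients begin.\<close>
    have set: "{a \<in> {1..r}. \<sigma> a \<noteq> id} = {1..?q}"
    proof (intro equalityI subsetI)
      fix a assume a: "a \<in> {a \<in> {1..r}. \<sigma> a \<noteq> id}"
      then have "a \<notin> {?q + 1..r}" using bot by blast
      then show "a \<in> {1..?q}" using a by auto
    next
      fix a assume a: "a \<in> {1..?q}"
      then have "a \<in> {1..r}" using a q by (meson atLeastAtMost_iff order_trans)
      then show "a \<in> {a \<in> {1..r}. \<sigma> a \<noteq> id}" using top[OF a] by blast
    qed
    have "{a \<in> {2..r}. \<sigma> a \<noteq> id} \<subseteq> {2}"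
    proof
      fix a assume a: "a \<in> {a \<in> {2..r}. \<sigma> a \<noteq> id}"
      then have "a \<in> {1..?q}" unfolding set[symmetric] by auto
      then show "a \<in> {2}" using a by (auto split: if_splits)
    qed
    then have card2: "card {a \<in> {2..r}. \<sigma> a \<noteq> id} \<le> 1" using card_mono[of "{2::nat}"] by simp
    have cardq: "card {a \<in> {1..r}. \<sigma> a \<noteq> id} = ?q" unfolding set by simp
    have ne: "Phi n ((\<alpha> \<circ> p) a) \<noteq> {}" if "a \<in> {1..r}" for a
      using assms(3) pr that by (metis imageI o_apply)
    let ?C = "minus_decomposable n (\<alpha> 1) \<longrightarrow> m = 2"
    have "(\<forall>a\<in>{1..r}. irreducible_perm n ((\<alpha> \<circ> p) a)) \<longleftrightarrow>
      (\<forall>b\<in>{1..m}. irreducible_decomposition (z b) (Delta (z b)) r (\<lambda>a. \<beta> a b)) \<and>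
      (\<forall>a\<in>{?q + 1..r}. \<exists>!b. b \<in> {1..m} \<and> \<beta> a b \<noteq> id) \<and>
      (\<forall>a\<in>{1..?q}. \<forall>b\<in>{1..m}. \<beta> a b = id) \<and> ?C"
    proof (rule irreducible_decomposition_inflation_iff[OF dec' ne inf q top bot])
      assume irr: "irreducible_perm n ((\<alpha> \<circ> p) 1)"
      show ?C
      proof
        assume "minus_decomposable n (\<alpha> 1)"
        then have "\<sigma> 1 = J m" using minus by blast
        then show "m = 2" using irreducible_J_inflation[OF inf[OF r1] _ irr m] by blast
      qed
    next
      fix a assume a: "a \<in> {1..?q}" and C: ?C and id: "\<forall>b\<in>{1..m}. \<beta> a b = id"
      have ar: "a \<in> {1..r}" using a q by (meson atLeastAtMost_iff order_trans)
      show "irreducible_perm n ((\<alpha> \<circ> p) a)"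
      proof (cases "minus_decomposable n (\<alpha> 1)")
        case True
        then have "a = 1" "m = 2" "\<sigma> a = J m" using a C minus by auto
        then show ?thesis using irreducible_J2_inflation[OF inf[OF ar]] id by blast
      next
        case False
        note s = simple[OF False]
        have "a = 1 \<or> a = 2" using a False by auto
        \<comment> \<open>For a = 2 the quotient is the reversal of \<open>\<sigma> 1\<close>, which
          is again simple.\<close>
        then have "simple_perm m (\<sigma> a)" using s simple_perm_J_comp[of m "\<sigma> 1"] by auto
        then show ?thesis using irreducible_simple_inflation[OF inf[OF ar]] s id by simp
      qed
    qed
    \<comment> \<open>The permutation p maps the index set onto itself, so irreducibility of all
      members does not depend on their order.\<close>
    moreover have "(\<forall>a\<in>{1..r}. irreducible_perm n ((\<alpha> \<circ> p) a)) \<longleftrightarrow>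
        (\<forall>a\<in>p ` {1..r}. irreducible_perm n (\<alpha> a))" by simp
    then have "(\<forall>a\<in>{1..r}. irreducible_perm n ((\<alpha> \<circ> p) a)) \<longleftrightarrow> irreducible_decomposition n (Delta n) r \<alpha>"
      unfolding pr irreducible_decomposition_def using dec by blast
    ultimately show ?thesis using \<sigma>1 card2 unfolding Let_def cardq by blast
  qed
  ultimately show ?thesis by blast
qed

end
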